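(* Let $\alpha$ and $\beta$ be positive integers. For real $x \geq 1$, let $M(x)$ denote the number of $(\alpha,\beta)$-multiamicable pairs $m, n$ of natural numbers with $m<n$ and $m\leq x$. Then $M(x)=o(x)$ as $x\rightarrow\infty$.
   Context: For a positive integer $n$, $\sigma(n)$ denotes the sum of all positive divisors of $n$. For positive integers $\alpha,\beta$, natural numbers (positive integers) $m, n$ form an $(\alpha,\beta)$-multiamicable pair if $\sigma(m)=\sigma(n)=\alpha m+\beta n$. Pairs are taken with $m<n$, the coefficient $\alpha$ being attached to the smaller element $m$ and $\beta$ to the larger element $n$. *)

theory Defs
  imports Complex_Main "HOL-Library.Landau_Symbols"
begin

text \<open>The divisor-sum is used only for positive arguments; note that \<open>divisor_sigma 0 = 0\<close> since
  the set of divisors of \<open>0\<close> is infinite.\<close>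

definition divisor_sigma :: "nat \<Rightarrow> nat" where
  "divisor_sigma n = (\<Sum>d | d dvd n. d)"

definition multiamicable :: "nat \<Rightarrow> nat \<Rightarrow> nat \<Rightarrow> nat \<Rightarrow> bool" where
  "multiamicable \<alpha> \<beta> m n \<longleftrightarrow>
     m > 0 \<and> n > 0 \<and> divisor_sigma m = divisor_sigma n \<and> divisor_sigma n = \<alpha> * m + \<beta> * n"

definition multiamicable_pairs :: "nat \<Rightarrow> nat \<Rightarrow> real \<Rightarrow> (nat \<times> nat) set" where
  "multiamicable_pairs \<alpha> \<beta> x =
     {(m, n). m < n \<and> multiamicable \<alpha> \<beta> m n \<and> real m \<le> x}"

definition multiamicable_count :: "nat \<Rightarrow> nat \<Rightarrow> real \<Rightarrow> nat" where
  "multiamicable_count \<alpha> \<beta> x = card (multiamicable_pairs \<alpha> \<beta> x)"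

text \<open>Only \<open>m\<close> is bounded by \<open>x\<close>, but the set is finite, so its cardinality is a genuine count:
  as \<open>\<beta> > 0\<close>, the equation \<open>divisor_sigma m = \<alpha> * m + \<beta> * n\<close> bounds \<open>n\<close> in terms of \<open>m\<close>.\<close>

lemma finite_multiamicable_pairs:
  assumes "\<beta> > 0"
  shows "finite (multiamicable_pairs \<alpha> \<beta> x)"
proof (rule finite_subset)
  show "multiamicable_pairs \<alpha> \<beta> x \<subseteq> (SIGMA m:{..nat \<lfloor>x\<rfloor>}. {..divisor_sigma m})"
  proof clarify
    fix m n assume "(m, n) \<in> multiamicable_pairs \<alpha> \<beta> x"
    then have eq: "divisor_sigma m = \<alpha> * m + \<beta> * n" and m: "real m \<le> x"
      by (auto simp: multiamicable_pairs_def multiamicable_def)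
    have "n \<le> \<beta> * n" using assms by simp
    then have "n \<le> divisor_sigma m" using eq by linarith
    moreover have "m \<le> nat \<lfloor>x\<rfloor>" using m by (rule le_nat_floor)
    ultimately show "m \<in> {..nat \<lfloor>x\<rfloor>} \<and> n \<in> {..divisor_sigma m}" by simp
  qed
qed auto

end

theory Submission
  imports Defs "HOL-Computational_Algebra.Primes" "HOL-Real_Asymp.Real_Asymp"
begin

text \<open>
  Write \<open>s\<close> for the divisor sum and \<open>L = ln N\<close>. A pair with \<open>s m = s n = \<alpha> m + \<beta> n\<close> is
  determined by either of its members, so all pairs may be discarded in which one member lies in a
  set with \<open>o(N)\<close> elements below \<open>N\<close>. As \<open>s m / m\<close> is bounded on average, pairs with
  \<open>s m \<ge> C m\<close> are rare for large \<open>C\<close>, and otherwise \<open>n \<le> s m \<le> C m\<close>; hence it suffices to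
  treat pairs with \<open>m, n \<le> N\<close>. The two members now play symmetric roles (up to exchanging
  \<open>\<alpha>\<close> and \<open>\<beta>\<close>), so let the largest prime factor \<open>Q\<close> of \<open>n\<close> be at least that of \<open>m\<close>
  (the set \<open>ordered_pairs\<close>), and let \<open>n = Q l\<close>.

  For all but \<open>o(N)\<close> integers \<open>n\<close>, namely the ``typical'' ones, \<open>Q\<close> does not divide \<open>l\<close> and the
  divisor sum of the cofactor \<open>l\<close> has a prime factor \<open>r > L^3\<close> (\<open>typical_cofactor\<close>): \<open>l\<close> has
  a prime factor \<open>q\<close> that is larger than \<open>exp (L^(4/5))\<close> and occurs only once, and integers
  \<open>q + 1\<close> of that size without a prime factor above \<open>L^3\<close> are very sparse. Since \<open>r\<close> divides
  \<open>s n = s m\<close> and \<open>m\<close> is not divisible by a large square, some prime \<open>p\<close> with \<open>p = -1\<close> modulo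
  \<open>r\<close> divides \<open>m\<close>, and \<open>p \<le> Q\<close> by the choice of \<open>Q\<close>. Now
  \<open>\<alpha> m = s n - \<beta> n = Q (s l - \<beta> l) + s l\<close>
  is linear in \<open>Q\<close>. Therefore, for given \<open>l\<close> and \<open>p\<close>, the number \<open>Q \<le> N / l\<close> lies in one
  residue class modulo \<open>p\<close> (\<open>typical_pair_congruence\<close>), which leaves at most \<open>2 N / (l p)\<close>
  choices because \<open>p \<le> Q\<close>. Summing \<open>1 / p\<close> over all integers \<open>p = -1\<close> modulo \<open>r\<close> gives
  \<open>O(L / r) = O(L / L^3)\<close>, and summing \<open>1 / l\<close> gives another factor \<open>L\<close>; the total is
  \<open>O(N / L)\<close> (\<open>card_linear_congruence_le\<close>).

  That atypical integers are rare (\<open>card_atypical_le\<close>) rests on two upper bounds: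
  Chebyshev's for the primes, obtained from the prime divisors of a central binomial coefficient,
  and Rankin's for the integers without large prime factors.
\<close>

section \<open>Counting multiples and reciprocal sums\<close>

lemma card_multiples:
  fixes d N :: nat assumes "d > 0"
  shows "real (card {n \<in> {1..N}. d dvd n}) \<le> real N / real d"
proof -
  have "{n \<in> {1..N}. d dvd n} \<subseteq> (\<lambda>k. d * k) ` {1..N div d}"
  proof
    fix n assume n: "n \<in> {n \<in> {1..N}. d dvd n}"
    then obtain k where k: "n = d * k" by auto
    with n assms have "k \<le> N div d" "k \<ge> 1"
      by (auto simp: less_eq_div_iff_mult_less_eq mult.commute intro: Suc_leI)
    then show "n \<in> (\<lambda>k. d * k) ` {1..N div d}" using k by auto
  qed
  then have "card {n \<in> {1..N}. d dvd n} \<le> card ((\<lambda>k. d * k) ` {1..N div d})"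
    by (intro card_mono) auto
  also have "\<dots> \<le> N div d" using card_image_le[of "{1..N div d}"] by simp
  finally have "real (card {n \<in> {1..N}. d dvd n}) \<le> real (N div d)" by simp
  also have "\<dots> \<le> real N / real d" by (rule of_nat_div_le_of_nat)
  finally show ?thesis .
qed

text \<open>The union bound behind nearly all estimates of exceptional sets below.\<close>

lemma card_multiples_of_some:
  fixes f :: "'a \<Rightarrow> nat"
  assumes "finite I" "\<And>i. i \<in> I \<Longrightarrow> f i > 0"
  shows "real (card {n \<in> {1..N}. \<exists>i\<in>I. f i dvd n}) \<le> real N * (\<Sum>i\<in>I. 1 / real (f i))"
proof -
  have "{n \<in> {1..N}. \<exists>i\<in>I. f i dvd n} = (\<Union>i\<in>I. {n \<in> {1..N}. f i dvd n})" by auto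
  then have "card {n \<in> {1..N}. \<exists>i\<in>I. f i dvd n} \<le> (\<Sum>i\<in>I. card {n \<in> {1..N}. f i dvd n})"
    using card_UN_le[OF assms(1)] by simp
  then have "real (card {n \<in> {1..N}. \<exists>i\<in>I. f i dvd n})
      \<le> (\<Sum>i\<in>I. real (card {n \<in> {1..N}. f i dvd n}))"
    by (simp only: of_nat_le_iff flip: of_nat_sum)
  also have "\<dots> \<le> (\<Sum>i\<in>I. real N / real (f i))"
    by (intro sum_mono card_multiples assms)
  also have "\<dots> = real N * (\<Sum>i\<in>I. 1 / real (f i))" by (simp add: sum_distrib_left)
  finally show ?thesis .
qed

lemma card_residue_class:
  fixes p Y :: nat
  assumes "p > 0" "S \<subseteq> {..Y}" "\<And>u v. u \<in> S \<Longrightarrow> v \<in> S \<Longrightarrow> u mod p = v mod p"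
  shows "real (card S) \<le> real Y / real p + 1"
proof -
  have "inj_on (\<lambda>u. u div p) S"
  proof (rule inj_onI)
    fix u v assume "u \<in> S" "v \<in> S" "u div p = v div p"
    moreover from this have "u mod p = v mod p" using assms(3)[of u v] by simp
    ultimately have "u div p * p + u mod p = v div p * p + v mod p" by simp
    then show "u = v" by (simp only: div_mult_mod_eq)
  qed
  moreover have "(\<lambda>u. u div p) ` S \<subseteq> {..Y div p}" using assms(2) by (auto intro: div_le_mono)
  ultimately have "card S \<le> card {..Y div p}" by (intro card_inj_on_le) auto
  then have "real (card S) \<le> real (Y div p) + 1" by simp
  also have "\<dots> \<le> real Y / real p + 1" using of_nat_div_le_of_nat[of Y p] by simp
  finally show ?thesis .
qed

text \<open>Markov inequality for the counting measure on \<open>S\<close>.\<close>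

lemma card_ge_le_sum_div:
  fixes w :: "'a \<Rightarrow> real"
  assumes "finite S" "\<And>n. n \<in> S \<Longrightarrow> w n \<ge> 0" "t > 0"
  shows "real (card {n \<in> S. w n \<ge> t}) \<le> (\<Sum>n\<in>S. w n) / t"
proof -
  have "real (card {n \<in> S. w n \<ge> t}) * t = (\<Sum>n\<in>{n \<in> S. w n \<ge> t}. t)" by simp
  also have "\<dots> \<le> (\<Sum>n\<in>{n \<in> S. w n \<ge> t}. w n)" by (intro sum_mono) auto
  also have "\<dots> \<le> (\<Sum>n\<in>S. w n)" by (intro sum_mono2) (use assms in auto)
  finally show ?thesis using assms(3) by (simp add: field_simps)
qed

lemma sum_inverse_le_ln:
  "n > 0 \<Longrightarrow> (\<Sum>k=1..n. 1 / real k) \<le> 1 + ln (real n)"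
proof (induction n rule: nat_induct_non_zero)
  case (Suc n)
  have "1 / real (Suc n) \<le> ln (real (Suc n)) - ln (real n)"
  proof -
    have "ln (real n / real (Suc n)) \<le> real n / real (Suc n) - 1"
      using Suc.hyps by (intro ln_le_minus_one) auto
    also have "\<dots> = - 1 / real (Suc n)" by (simp add: field_simps)
    finally show ?thesis using Suc.hyps by (simp add: ln_div)
  qed
  then show ?case using Suc.IH by (simp add: sum.nat_ivl_Suc')
qed simp

text \<open>Compare with a telescoping sum: \<open>1 / d^2 \<le> 1 / (d - 1/2) - 1 / (d + 1/2)\<close>.\<close>

lemma sum_inverse_squares_tail:
  fixes D :: real
  assumes "D > 0" "finite I" "\<And>d. d \<in> I \<Longrightarrow> real d > D"
  shows "(\<Sum>d\<in>I. 1 / (real d)\<^sup>2) \<le> 2 / D"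
proof -
  define k where "k = nat \<lceil>D\<rceil>"
  have k: "real k \<ge> D" "k > 0" "real k < D + 1" using assms(1) by (auto simp: k_def) linarith+
  define g where "g d = 1 / (real d - 1/2)" for d :: nat
  have step: "1 / (real d)\<^sup>2 \<le> g d - g (Suc d)" if "d \<ge> 1" for d
  proof -
    have d: "real d \<ge> 1" using that by simp
    have pos: "(real d - 1/2) * (real d + 1/2) > 0" using d by (intro mult_pos_pos) auto
    have "g d - g (Suc d) = 1 / ((real d - 1/2) * (real d + 1/2))"
      unfolding g_def using d by (simp add: divide_simps)
    moreover have "(real d - 1/2) * (real d + 1/2) \<le> (real d)\<^sup>2"
      by (simp add: algebra_simps power2_eq_square)
    ultimately show ?thesis using pos by (simp add: frac_le)
  qed
  have tail: "(\<Sum>d=k..<k+j. 1 / (real d)\<^sup>2) \<le> g k - g (k+j)" for j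
  proof (induction j)
    case (Suc j)
    then show ?case using step[of "k+j"] k by simp
  qed simp
  obtain j where j: "I \<subseteq> {k..<k+j}"
  proof -
    obtain M where M: "\<forall>d\<in>I. d < M" using assms(2) finite_nat_set_iff_bounded by blast
    have "k \<le> d" if "d \<in> I" for d
      using assms(3)[OF that] by (auto simp: k_def ceiling_le_iff)
    then have "I \<subseteq> {k..<k+M}" using M by fastforce
    then show ?thesis by (rule that)
  qed
  have "(\<Sum>d\<in>I. 1 / (real d)\<^sup>2) \<le> (\<Sum>d=k..<k+j. 1 / (real d)\<^sup>2)"
    by (intro sum_mono2 j) auto
  also have "\<dots> \<le> g k - g (k+j)" by (rule tail)
  also have "\<dots> \<le> g k" using k by (simp add: g_def)
  also have "\<dots> \<le> 2 / real k" using k(2) by (simp add: g_def field_simps)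
  also have "\<dots> \<le> 2 / D" using k assms(1) by (intro divide_left_mono) auto
  finally show ?thesis .
qed

text \<open>The elements of the class are \<open>j p - 1 \<ge> j p / 2\<close> with \<open>j \<ge> 1\<close>, so the sum is at most
  \<open>2 / p\<close> times a harmonic sum. This saving of a factor \<open>p\<close> is what makes the condition that a
  prime factor of \<open>n\<close> lies in the class a rare event for large \<open>p\<close>.\<close>

lemma sum_inverse_class_le:
  fixes p N :: nat assumes "p \<ge> 2"
  shows "(\<Sum>k | k \<in> {1..N} \<and> p dvd k + 1. 1 / real k) \<le> 2 * (1 + ln (real N)) / real p"
proof (cases "N = 0")
  case False
  define K where "K = {k \<in> {1..N}. p dvd k + 1}"
  have K: "finite K" by (simp add: K_def)
  have quot: "k + 1 = p * ((k + 1) div p)" if "k \<in> K" for k using that by (simp add: K_def)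
  have "(\<Sum>k\<in>K. 1 / real k) \<le> (\<Sum>k\<in>K. 2 / real p * (1 / real ((k + 1) div p)))"
  proof (rule sum_mono)
    fix k assume k: "k \<in> K"
    then have "real p * real ((k + 1) div p) = real k + 1" using quot by (metis of_nat_1 of_nat_add of_nat_mult)
    moreover have "k \<ge> 1" using k by (simp add: K_def)
    ultimately have "1 / real k \<le> 2 / (real p * real ((k + 1) div p))" by (simp add: field_simps)
    then show "1 / real k \<le> 2 / real p * (1 / real ((k + 1) div p))" by simp
  qed
  also have "\<dots> = 2 / real p * (\<Sum>k\<in>K. 1 / real ((k + 1) div p))" by (simp add: sum_distrib_left)
  also have "(\<Sum>k\<in>K. 1 / real ((k + 1) div p)) = (\<Sum>j\<in>(\<lambda>k. (k + 1) div p) ` K. 1 / real j)"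
    by (subst sum.reindex) (auto intro!: inj_onI dest!: quot)
  also have "\<dots> \<le> (\<Sum>j=1..N. 1 / real j)"
  proof (intro sum_mono2 subsetI)
    fix j assume "j \<in> (\<lambda>k. (k + 1) div p) ` K"
    then obtain k where k: "k \<in> K" "j = (k + 1) div p" by blast
    then have eq: "k + 1 = p * j" using quot by simp
    then have "j \<ge> 1" by (cases j) auto
    moreover have "2 * j \<le> k + 1" unfolding eq using assms by simp
    ultimately show "j \<in> {1..N}" using k by (auto simp: K_def)
  qed auto
  also have "\<dots> \<le> 1 + ln (real N)" using False by (intro sum_inverse_le_ln) simp
  finally show ?thesis by (simp add: K_def mult_left_mono divide_right_mono)
qed simp

section \<open>The divisor sum\<close>

lemma divisor_sigma_mult_coprime:
  assumes "coprime a b"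
  shows "divisor_sigma (a * b) = divisor_sigma a * divisor_sigma b"
proof (cases "a = 0 \<or> b = 0")
  case False
  have inj: "inj_on (\<lambda>(x, y). x * y) ({d. d dvd a} \<times> {d. d dvd b})"
  proof (rule inj_onI, clarsimp)
    fix x y x' y' assume dv: "x dvd a" "y dvd b" "x' dvd a" "y' dvd b" and eq: "x * y = x' * y'"
    have "coprime x y'" "coprime x' y"
      using dv assms by (meson coprime_divisors)+
    then have "x dvd x'" "x' dvd x"
      using eq by (metis coprime_dvd_mult_left_iff dvd_triv_left)+
    then have "x = x'" by (rule dvd_antisym)
    moreover have "x > 0" using dv False by (auto intro: Nat.gr0I)
    ultimately show "x = x' \<and> y = y'" using eq by simp
  qed
  have img: "(\<lambda>(x, y). x * y) ` ({d. d dvd a} \<times> {d. d dvd b}) = {d. d dvd a * b}"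
  proof (intro equalityI subsetI)
    fix d assume "d \<in> {d. d dvd a * b}"
    then obtain x y where "d = x * y" "x dvd a" "y dvd b" using division_decomp by blast
    then show "d \<in> (\<lambda>(x, y). x * y) ` ({d. d dvd a} \<times> {d. d dvd b})" by auto
  qed (auto intro: mult_dvd_mono)
  have "divisor_sigma (a * b) = (\<Sum>(x, y)\<in>{d. d dvd a} \<times> {d. d dvd b}. x * y)"
    unfolding divisor_sigma_def img[symmetric] by (subst sum.reindex[OF inj]) (simp add: case_prod_unfold)
  also have "\<dots> = divisor_sigma a * divisor_sigma b"
    unfolding divisor_sigma_def by (simp add: sum_product sum.cartesian_product)
  finally show ?thesis .
qed (auto simp: divisor_sigma_def)

lemma divisor_sigma_prime_power:
  assumes "prime p"
  shows "divisor_sigma (p ^ k) = (\<Sum>i\<le>k. p ^ i)"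
proof -
  have "{d. d dvd p ^ k} = (\<lambda>i. p ^ i) ` {..k}"
    using assms by (auto simp: divides_primepow_nat)
  moreover have "inj_on (\<lambda>i. p ^ i) {..k}"
    using prime_gt_1_nat[OF assms] by (auto intro!: inj_onI)
  ultimately show ?thesis by (simp add: divisor_sigma_def sum.reindex)
qed

lemma divisor_sigma_prime: "prime p \<Longrightarrow> divisor_sigma p = p + 1"
  using divisor_sigma_prime_power[of p 1] by simp

lemma divisor_sigma_prime_power_less:
  assumes "prime p"
  shows "divisor_sigma (p ^ k) < 2 * p ^ k"
proof (induction k)
  case (Suc k)
  have "2 * p ^ k \<le> p ^ Suc k" using prime_ge_2_nat[OF assms] by simp
  moreover have "divisor_sigma (p ^ Suc k) = divisor_sigma (p ^ k) + p ^ Suc k"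
    by (simp only: divisor_sigma_prime_power[OF assms] sum.atMost_Suc)
  ultimately show ?case using Suc by linarith
qed (simp add: divisor_sigma_def)

lemma divisor_sigma_pos: "n > 0 \<Longrightarrow> divisor_sigma n > 0"
  unfolding divisor_sigma_def by (intro sum_pos2[of _ n]) auto

text \<open>A prime dividing \<open>s n\<close> divides \<open>s (p ^ k)\<close> for a prime power \<open>p ^ k\<close> exactly dividing \<open>n\<close>.
  For \<open>k = 1\<close> this is \<open>p + 1\<close>. For \<open>k \<ge> 2\<close> the square of \<open>d = p ^ (k div 2)\<close> divides \<open>n\<close>, and
  \<open>s (p ^ k) < 2 p ^ k \<le> 2 d ^ 3\<close> with equality of exponents at \<open>k = 3\<close>.\<close>

lemma prime_dvd_divisor_sigma:
  assumes "prime q" "n > 0" "q dvd divisor_sigma n"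
  shows "(\<exists>p. prime p \<and> p dvd n \<and> q dvd p + 1) \<or> (\<exists>d. d\<^sup>2 dvd n \<and> q < 2 * d ^ 3)"
  using assms(2,3)
proof (induction n rule: less_induct)
  case (less n)
  show ?case
  proof (cases "n = 1")
    case True
    then show ?thesis using less.prems assms(1) by (simp add: divisor_sigma_def)
  next
    case False
    then obtain p where p: "prime p" "p dvd n" using prime_factor_nat by blast
    obtain k m where nk: "n = p ^ k * m" and m: "\<not> p dvd m"
      using prime_power_canonical[OF p(1)] less.prems(1) by (metis mult.commute)
    have k: "k > 0" using nk m p by (cases k) auto
    have "coprime (p ^ k) m" using p(1) m by (simp add: prime_imp_coprime)
    then have "q dvd divisor_sigma (p ^ k) * divisor_sigma m"
      using less.prems(2) nk by (simp add: divisor_sigma_mult_coprime)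
    then consider "q dvd divisor_sigma (p ^ k)" | "q dvd divisor_sigma m"
      using assms(1) by (auto simp: prime_dvd_mult_iff)
    then show ?thesis
    proof cases
      case 1
      show ?thesis
      proof (cases "k = 1")
        case True
        then show ?thesis using 1 p divisor_sigma_prime[OF p(1)] by auto
      next
        case False
        define d where "d = p ^ (k div 2)"
        have "q \<le> divisor_sigma (p ^ k)"
          using 1 p(1) by (intro dvd_imp_le divisor_sigma_pos) (auto simp: prime_gt_0_nat)
        also have "\<dots> < 2 * p ^ k" by (rule divisor_sigma_prime_power_less[OF p(1)])
        also have "p ^ k \<le> p ^ (k div 2 * 3)"
          using False k prime_ge_1_nat[OF p(1)] by (intro power_increasing) auto
        also have "\<dots> = d ^ 3" by (simp add: d_def power_mult)
        finally have "q < 2 * d ^ 3" by simp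
        moreover have "d\<^sup>2 dvd n"
        proof -
          have "d\<^sup>2 = p ^ (k div 2 * 2)" by (simp add: d_def power_mult)
          also have "\<dots> dvd p ^ k" by (intro le_imp_power_dvd) auto
          finally show ?thesis by (simp add: nk)
        qed
        ultimately show ?thesis by blast
      qed
    next
      case 2
      have "m > 0" using nk less.prems(1) by (auto intro: Nat.gr0I)
      moreover have "m < n"
      proof -
        have "1 < p ^ k" using prime_gt_1_nat[OF p(1)] k by (intro one_less_power)
        then show ?thesis using \<open>m > 0\<close> nk by simp
      qed
      moreover have "m dvd n" using nk by simp
      ultimately show ?thesis using less.IH[of m] 2 by (meson dvd_trans)
    qed
  qed
qed

lemma divisor_sigma_div:
  assumes "n > 0"
  shows "real (divisor_sigma n) / real n = (\<Sum>d | d dvd n. 1 / real d)"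
proof -
  have "real (divisor_sigma n) / real n = (\<Sum>d | d dvd n. real d / real n)"
    by (simp add: divisor_sigma_def sum_divide_distrib)
  also have "\<dots> = (\<Sum>d | d dvd n. 1 / real d)"
    by (rule sum.reindex_bij_witness[of _ "\<lambda>d. n div d" "\<lambda>d. n div d"])
       (use assms in \<open>auto simp: real_of_nat_div\<close>)
  finally show ?thesis .
qed

text \<open>On average \<open>s n / n\<close> is bounded: it is the sum of \<open>1 / d\<close> over the divisors of \<open>n\<close>, and
  \<open>d\<close> divides at most \<open>N / d\<close> integers up to \<open>N\<close>. The constant comes from the tail
  estimate with \<open>D = 1/2\<close>.\<close>

lemma sum_divisor_sigma_div:
  "(\<Sum>n\<in>{1..N}. real (divisor_sigma n) / real n) \<le> 4 * real N"
proof -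
  have "(\<Sum>n\<in>{1..N}. real (divisor_sigma n) / real n)
      = (\<Sum>n\<in>{1..N}. \<Sum>d\<in>{1..N}. if d dvd n then 1 / real d else 0)"
  proof (rule sum.cong[OF refl])
    fix n assume n: "n \<in> {1..N}"
    then have "{d. d dvd n} = {d \<in> {1..N}. d dvd n}" by (auto dest: dvd_imp_le intro: Suc_leI Nat.gr0I)
    then show "real (divisor_sigma n) / real n = (\<Sum>d\<in>{1..N}. if d dvd n then 1 / real d else 0)"
      using divisor_sigma_div[of n] n by (simp only: sum.inter_filter finite_atLeastAtMost) simp
  qed
  also have "\<dots> = (\<Sum>d\<in>{1..N}. \<Sum>n\<in>{1..N}. if d dvd n then 1 / real d else 0)" by (rule sum.swap)
  also have "\<dots> = (\<Sum>d\<in>{1..N}. real (card {n \<in> {1..N}. d dvd n}) / real d)"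
    by (intro sum.cong refl) (simp flip: sum.inter_filter)
  also have "\<dots> \<le> (\<Sum>d\<in>{1..N}. real N / real d / real d)"
    by (intro sum_mono divide_right_mono card_multiples) auto
  also have "\<dots> = real N * (\<Sum>d=1..N. 1 / (real d)\<^sup>2)"
    by (simp add: sum_distrib_left power2_eq_square)
  also have "(\<Sum>d=1..N. 1 / (real d)\<^sup>2) \<le> 2 / (1/2)"
    by (intro sum_inverse_squares_tail) auto
  finally show ?thesis by (simp add: mult_left_mono)
qed

section \<open>Chebyshev bounds for primes\<close>

lemma primes_prod_dvd:
  fixes F :: "nat set"
  assumes "finite F" "\<And>p. p \<in> F \<Longrightarrow> prime p \<and> p dvd n"
  shows "\<Prod>F dvd n"
  using assms
proof (induction F rule: finite_induct)
  case (insert p F)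
  have "coprime p (\<Prod>F)" 
    by (rule prod_coprime_right) (use insert in \<open>auto intro!: primes_coprime\<close>)
  then show ?case using insert by (auto intro: divides_mult)
qed simp

text \<open>Every prime in the block divides the binomial coefficient \<open>2 n\<close> over \<open>n\<close>, which is at most
  \<open>4 ^ n\<close>.\<close>

lemma primes_dyadic_block:
  fixes n :: nat assumes "n > 0"
  shows "(\<Sum>p | prime p \<and> n < p \<and> p \<le> 2*n. ln (real p) / real p) \<le> ln 4"
proof -
  define F where "F = {p. prime p \<and> n < p \<and> p \<le> 2*n}"
  have fin: "finite F" by (rule finite_subset[of _ "{..2*n}"]) (auto simp: F_def)
  have "p dvd (2*n choose n)" if "p \<in> F" for p
  proof -
    have p: "prime p" "n < p" "p \<le> 2*n" using that by (auto simp: F_def)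
    have "p dvd fact (2*n)" using p by (simp add: prime_dvd_fact_iff)
    moreover have "fact (2*n) = fact n * fact n * (2*n choose n)"
      using binomial_fact_lemma[of n "2*n"] by simp
    moreover have "\<not> p dvd fact n" using p by (simp add: prime_dvd_fact_iff)
    ultimately show ?thesis using p(1) by (simp add: prime_dvd_mult_iff)
  qed
  then have "\<Prod>F dvd (2*n choose n)"
    by (intro primes_prod_dvd fin) (auto simp: F_def)
  then have "\<Prod>F \<le> (2*n choose n)" by (intro dvd_imp_le) auto
  also have "\<dots> \<le> (\<Sum>k\<le>2*n. 2*n choose k)" by (intro member_le_sum) auto
  also have "\<dots> = 4 ^ n" by (simp only: choose_row_sum) (simp add: power_mult)
  finally have "real (\<Prod>F) \<le> real (4 ^ n)" by (simp only: of_nat_le_iff)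
  then have "real (\<Prod>F) \<le> 4 ^ n" by simp
  moreover have "ln (real (\<Prod>F)) = (\<Sum>p\<in>F. ln (real p))"
  proof -
    have "ln (real (\<Prod>F)) = ln (\<Prod>p\<in>F. real p)" by simp
    also have "\<dots> = (\<Sum>p\<in>F. ln (real p))"
      using fin by (intro ln_prod) (auto simp: F_def prime_gt_0_nat)
    finally show ?thesis .
  qed
  moreover have "real (\<Prod>F) > 0" using fin by (auto simp: F_def prime_gt_0_nat intro!: prod_pos)
  ultimately have *: "(\<Sum>p\<in>F. ln (real p)) \<le> real n * ln 4"
    by (metis ln_le_cancel_iff ln_realpow zero_less_numeral zero_less_power)
  have "(\<Sum>p\<in>F. ln (real p) / real p) \<le> (\<Sum>p\<in>F. ln (real p) / real n)"
    using assms by (intro sum_mono divide_left_mono) (auto simp: F_def)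
  also have "\<dots> = (\<Sum>p\<in>F. ln (real p)) / real n" by (simp add: sum_divide_distrib)
  also have "\<dots> \<le> ln 4" using * assms by (simp add: field_simps)
  finally show ?thesis by (simp add: F_def)
qed

lemma primes_dyadic_blocks:
  fixes n k :: nat assumes "n > 0"
  shows "(\<Sum>p | prime p \<and> n < p \<and> p \<le> 2^k * n. ln (real p) / real p) \<le> real k * ln 4"
proof (induction k)
  case 0
  have empty: "{p. prime p \<and> n < p \<and> p \<le> 2^0 * n} = {}" by auto
  show ?case by (simp only: empty) simp
next
  case (Suc k)
  let ?f = "\<lambda>p::nat. ln (real p) / real p"
  let ?A = "{p. prime p \<and> n < p \<and> p \<le> 2^k * n}"
  let ?B = "{p. prime p \<and> 2^k * n < p \<and> p \<le> 2 * (2^k * n)}"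
  have "n \<le> 2^k * n" by simp
  then have eq: "{p. prime p \<and> n < p \<and> p \<le> 2^Suc k * n} = ?A \<union> ?B"
    using le_less_trans[OF \<open>n \<le> 2^k * n\<close>] by (auto simp: not_le)
  have "finite ?A" by (rule finite_subset[of _ "{..2^k * n}"]) auto
  moreover have "finite ?B" by (rule finite_subset[of _ "{..2 * (2^k * n)}"]) auto
  ultimately have "sum ?f (?A \<union> ?B) = sum ?f ?A + sum ?f ?B"
    by (intro sum.union_disjoint) auto
  also have "sum ?f ?B \<le> ln 4" using assms by (intro primes_dyadic_block) simp
  finally show ?case using Suc by (simp only: eq) (simp add: algebra_simps)
qed

text \<open>Cover the interval by dyadic blocks; about \<open>log 2 (b / a) + 2\<close> of them suffice, and each
  contributes at most \<open>2 ln 2\<close>. Only the proportionality to \<open>ln (b / a)\<close> matters, not the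
  factor \<open>2\<close>.\<close>

lemma sum_primes_ln_div_le:
  fixes a b :: real
  assumes "1 \<le> a" "a \<le> b"
  shows "(\<Sum>p | prime p \<and> a < real p \<and> real p \<le> b. ln (real p) / real p) \<le> 2 * ln (b / a) + 4"
proof -
  define n where "n = nat \<lfloor>a\<rfloor>"
  define k where "k = nat \<lceil>log 2 (b / n)\<rceil>"
  have n: "n > 0" "real n \<le> a" "a < real n + 1" using assms(1) by (auto simp: n_def)
  then have "real n \<ge> 1" by simp
  then have n': "a \<le> 2 * real n" using n by linarith
  have "b / n \<ge> 1" using n assms by simp
  then have kge: "log 2 (b / n) \<le> real k" and kle: "real k \<le> log 2 (b / n) + 1"
    by (auto simp: k_def)
  have "b / n = 2 powr log 2 (b / n)" using \<open>b / n \<ge> 1\<close> by simp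
  also have "\<dots> \<le> 2 powr real k" using kge by simp
  finally have b: "b \<le> 2 ^ k * real n" using n by (simp add: powr_realpow field_simps)
  have sub: "{p. prime p \<and> a < real p \<and> real p \<le> b} \<subseteq> {p. prime p \<and> n < p \<and> p \<le> 2^k * n}"
  proof safe
    fix p :: nat assume p: "a < real p" "real p \<le> b"
    show "n < p" using p n by linarith
    have "real p \<le> real (2^k * n)" using p b by simp
    then show "p \<le> 2^k * n" by (simp only: of_nat_le_iff)
  qed
  have "(\<Sum>p | prime p \<and> a < real p \<and> real p \<le> b. ln (real p) / real p)
      \<le> (\<Sum>p | prime p \<and> n < p \<and> p \<le> 2^k * n. ln (real p) / real p)"
    by (rule sum_mono2[OF _ sub]) (auto intro: finite_subset[of _ "{..2^k * n}"] simp: prime_gt_0_nat)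
  also have "\<dots> \<le> real k * ln 4" using n by (intro primes_dyadic_blocks)
  also have "ln (4::real) = 2 * ln 2" using ln_realpow[of "2::real" 2] by simp
  also have "real k * (2 * ln 2) \<le> (log 2 (b / n) + 1) * (2 * ln 2)"
    using kle by (intro mult_right_mono) auto
  also have "\<dots> = 2 * ln (b / n) + 2 * ln 2" by (simp add: log_def algebra_simps)
  also have "ln (b / n) \<le> ln (2 * (b / a))"
  proof -
    have "1 / real n \<le> 2 / a" using n n' assms by (simp add: divide_simps)
    then have "b * (1 / real n) \<le> b * (2 / a)" using assms by (intro mult_left_mono) auto
    then show ?thesis using n n' assms by (intro ln_mono) (auto simp: field_simps)
  qed
  also have "ln (2 * (b / a)) = ln 2 + ln (b / a)" using assms by (simp add: ln_mult del: times_divide_eq_right)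
  finally show ?thesis using ln_2_less_1 by simp
qed

section \<open>The smooth part of an integer\<close>

text \<open>The multiplicity of \<open>p\<close> in \<open>n\<close> counts the \<open>j \<ge> 1\<close> with \<open>p ^ j dvd n\<close>, and the proportions
  \<open>1 / p ^ j\<close> form a geometric series.\<close>

lemma sum_multiplicity_le:
  fixes p N :: nat assumes p: "prime p"
  shows "(\<Sum>n\<in>{1..N}. real (multiplicity p n)) \<le> real N / (real p - 1)"
proof -
  have p1: "real p > 1" using prime_gt_1_nat[OF p] by simp
  have geo: "(\<Sum>j\<in>{1..M}. 1 / real p ^ j) \<le> (1 - 1 / real p ^ M) / (real p - 1)" for M
  proof (induction M)
    case (Suc M)
    have "(1 - 1 / real p ^ M) / (real p - 1) + 1 / real p ^ Suc M = (1 - 1 / real p ^ Suc M) / (real p - 1)"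
      using p1 by (simp add: divide_simps) (simp add: algebra_simps)
    then show ?case using Suc by simp
  qed simp
  have "(\<Sum>n\<in>{1..N}. real (multiplicity p n)) = (\<Sum>n\<in>{1..N}. \<Sum>j\<in>{1..N}. if p ^ j dvd n then 1 else 0)"
  proof (rule sum.cong[OF refl])
    fix n assume n: "n \<in> {1..N}"
    have iff: "p ^ j dvd n \<longleftrightarrow> j \<le> multiplicity p n" for j
      using n p by (intro power_dvd_iff_le_multiplicity) auto
    have "multiplicity p n < p ^ multiplicity p n" using prime_gt_1_nat[OF p] by (simp add: power_gt_expt)
    also have "\<dots> \<le> n" using n by (intro dvd_imp_le multiplicity_dvd) auto
    finally have "{j \<in> {1..N}. p ^ j dvd n} = {1..multiplicity p n}" using n by (auto simp: iff)
    then have "real (multiplicity p n) = real (card {j \<in> {1..N}. p ^ j dvd n})" by simp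
    also have "\<dots> = (\<Sum>j\<in>{1..N}. if p ^ j dvd n then 1 else 0)"
      by (simp flip: sum.inter_filter)
    finally show "real (multiplicity p n) = (\<Sum>j\<in>{1..N}. if p ^ j dvd n then 1 else 0)" .
  qed
  also have "\<dots> = (\<Sum>j\<in>{1..N}. \<Sum>n\<in>{1..N}. if p ^ j dvd n then 1 else 0)" by (rule sum.swap)
  also have "\<dots> = (\<Sum>j\<in>{1..N}. real (card {n \<in> {1..N}. p ^ j dvd n}))"
    by (intro sum.cong refl) (simp flip: sum.inter_filter)
  also have "\<dots> \<le> (\<Sum>j\<in>{1..N}. real N / real (p ^ j))"
    using p by (intro sum_mono card_multiples) (simp add: prime_gt_0_nat)
  also have "\<dots> = real N * (\<Sum>j\<in>{1..N}. 1 / real p ^ j)" by (simp add: sum_distrib_left)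
  also have "(\<Sum>j\<in>{1..N}. 1 / real p ^ j) \<le> (1 - 1 / real p ^ N) / (real p - 1)" by (rule geo)
  also have "\<dots> \<le> 1 / (real p - 1)" using p1 by (intro divide_right_mono) auto
  finally show ?thesis by (simp add: mult_left_mono)
qed

text \<open>The logarithm of the largest divisor of \<open>n\<close> (for \<open>n > 0\<close>) all of whose prime factors are at
  most \<open>A\<close>.\<close>

definition smooth_part_ln :: "real \<Rightarrow> nat \<Rightarrow> real" where
  "smooth_part_ln A n = (\<Sum>p | prime p \<and> real p \<le> A. real (multiplicity p n) * ln (real p))"

lemma finite_primes_le: "finite {p::nat. prime p \<and> real p \<le> A}"
proof (rule finite_subset)
  show "{p::nat. prime p \<and> real p \<le> A} \<subseteq> {..nat \<lfloor>A\<rfloor>}" by (auto intro: le_nat_floor)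
qed simp

lemma smooth_part_ln_nonneg: "smooth_part_ln A n \<ge> 0"
  unfolding smooth_part_ln_def by (intro sum_nonneg) (auto simp: prime_ge_Suc_0_nat)

lemma sum_smooth_part_ln_le:
  assumes "A \<ge> 1"
  shows "(\<Sum>n\<in>{1..N}. smooth_part_ln A n) \<le> 2 * real N * (2 * ln A + 4)"
proof -
  let ?P = "{p::nat. prime p \<and> real p \<le> A}"
  have "(\<Sum>n\<in>{1..N}. smooth_part_ln A n) = (\<Sum>p\<in>?P. ln (real p) * (\<Sum>n\<in>{1..N}. real (multiplicity p n)))"
    unfolding smooth_part_ln_def by (subst sum.swap) (simp add: sum_distrib_left mult.commute)
  also have "\<dots> \<le> (\<Sum>p\<in>?P. 2 * real N * (ln (real p) / real p))"
  proof (rule sum_mono)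
    fix p assume "p \<in> ?P"
    then have p: "prime p" by simp
    have p2: "real p \<ge> 2" using prime_ge_2_nat[OF p] by simp
    have "(\<Sum>n\<in>{1..N}. real (multiplicity p n)) \<le> real N / (real p - 1)" by (rule sum_multiplicity_le[OF p])
    also have "\<dots> \<le> real N / (real p / 2)" using p2 by (intro divide_left_mono) auto
    finally have "ln (real p) * (\<Sum>n\<in>{1..N}. real (multiplicity p n)) \<le> ln (real p) * (real N / (real p / 2))"
      using p2 by (intro mult_left_mono) auto
    then show "ln (real p) * (\<Sum>n\<in>{1..N}. real (multiplicity p n)) \<le> 2 * real N * (ln (real p) / real p)"
      by (simp add: field_simps)
  qed
  also have "\<dots> = 2 * real N * (\<Sum>p\<in>?P. ln (real p) / real p)" by (simp add: sum_distrib_left)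
  also have "?P = {p. prime p \<and> 1 < real p \<and> real p \<le> A}" by (auto simp: prime_gt_Suc_0_nat)
  also have "(\<Sum>p | prime p \<and> 1 < real p \<and> real p \<le> A. ln (real p) / real p) \<le> 2 * ln A + 4"
    using sum_primes_ln_div_le[of 1 A] assms by simp
  finally show ?thesis by (simp add: mult_left_mono)
qed

text \<open>A divisor composed of primes up to \<open>A\<close> divides the \<open>A\<close>-smooth part of \<open>n\<close>.\<close>

lemma ln_smooth_divisor_le:
  assumes "n > 0" "k dvd n" "\<And>p. prime p \<Longrightarrow> p dvd k \<Longrightarrow> real p \<le> A"
  shows "ln (real k) \<le> smooth_part_ln A n"
proof -
  have k: "k > 0" using assms by (auto intro: Nat.gr0I)
  have "real k = (\<Prod>p\<in>prime_factors k. real p ^ multiplicity p k)"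
    by (subst prime_factorization_nat[OF k]) simp
  then have "ln (real k) = (\<Sum>p\<in>prime_factors k. ln (real p ^ multiplicity p k))"
    by (simp only:) (rule ln_prod, auto simp: in_prime_factors_iff prime_gt_0_nat)
  also have "\<dots> = (\<Sum>p\<in>prime_factors k. real (multiplicity p k) * ln (real p))"
    by (intro sum.cong refl ln_realpow)
  also have "\<dots> \<le> (\<Sum>p\<in>prime_factors k. real (multiplicity p n) * ln (real p))"
    using assms by (intro sum_mono mult_right_mono)
      (auto simp: in_prime_factors_iff prime_ge_Suc_0_nat intro!: dvd_imp_multiplicity_le)
  also have "\<dots> \<le> smooth_part_ln A n"
    unfolding smooth_part_ln_def using assms(3)
    by (intro sum_mono2 finite_primes_le) (auto simp: in_prime_factors_iff prime_ge_Suc_0_nat)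
  finally show ?thesis .
qed

section \<open>Rankin bound for smooth integers\<close>

text \<open>The left-hand side is part of a geometric series with ratio \<open>t = p powr (-3/4)\<close>. As
  \<open>t \<le> 2/3\<close> for \<open>p \<ge> 2\<close>, its sum \<open>1 / (1 - t)\<close> is at most \<open>1 + 3 t\<close>.\<close>

lemma euler_factor_le:
  fixes p :: nat assumes "p \<ge> 2"
  shows "(\<Sum>j\<le>K. real (p ^ j) powr (-3/4)) \<le> exp (3 * real p powr (-3/4))"
proof -
  define t where "t = real p powr (-3/4)"
  have "t \<le> 2 powr (-3/4)" unfolding t_def using assms by (intro powr_mono2') auto
  also have "(2::real) powr (-3/4) \<le> 2/3"
  proof (rule power_le_imp_le_base)
    have "((2::real) powr (-3/4)) ^ Suc 3 = 2 powr (-3)"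
      by (simp flip: powr_realpow add: powr_powr)
    also have "\<dots> = 1 / 8" by (simp add: powr_minus powr_numeral)
    also have "\<dots> \<le> (2/3) ^ Suc 3" by (simp add: power_def)
    finally show "((2::real) powr (-3/4)) ^ Suc 3 \<le> (2/3) ^ Suc 3" .
  qed simp
  finally have t: "0 \<le> t" "t \<le> 2/3" by (auto simp: t_def)
  have "(\<Sum>j\<le>K. real (p ^ j) powr (-3/4)) = (\<Sum>j\<le>K. t ^ j)"
    using assms by (intro sum.cong) (auto simp: t_def powr_powr mult.commute simp flip: powr_realpow)
  also have "\<dots> \<le> 1 / (1 - t)"
    using t by (simp add: sum_gp0 divide_right_mono)
  also have "\<dots> \<le> 1 + 3 * t"
  proof -
    have "0 \<le> t * (2 - 3 * t)" using t by (intro mult_nonneg_nonneg) auto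
    then have "1 \<le> (1 + 3 * t) * (1 - t)" by (simp add: algebra_simps)
    then show ?thesis using t by (simp add: divide_simps)
  qed
  also have "\<dots> \<le> exp (3 * t)" by (rule exp_ge_add_one_self)
  finally show ?thesis by (simp add: t_def)
qed

text \<open>Expanding the Euler product over \<open>F\<close> yields every integer composed of primes in \<open>F\<close>; the
  truncation at \<open>K\<close> keeps the sums finite.\<close>

lemma sum_over_prime_set_le:
  fixes F :: "nat set"
  assumes "finite F" "\<And>p. p \<in> F \<Longrightarrow> prime p"
  shows "(\<Sum>k | k \<in> {1..K} \<and> prime_factors k \<subseteq> F. real k powr (-3/4))
           \<le> exp (3 * (\<Sum>p\<in>F. real p powr (-3/4)))"
  using assms
proof (induction F rule: finite_induct)
  case empty
  have "{k. k \<in> {1..K} \<and> prime_factors k \<subseteq> {}} \<subseteq> {1}"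
    by (auto simp: prime_factorization_empty_iff)
  then have "(\<Sum>k | k \<in> {1..K} \<and> prime_factors k \<subseteq> {}. real k powr (-3/4))
      \<le> (\<Sum>k\<in>{1}. real k powr (-3/4))"
    by (intro sum_mono2) auto
  then show ?case by simp
next
  case (insert p F)
  let ?S = "\<lambda>F. {k. k \<in> {1..K} \<and> prime_factors k \<subseteq> F}"
  have p: "prime p" using insert.prems by simp
  have fin: "finite (?S F)" by simp
  have sub: "?S (insert p F) \<subseteq> (\<lambda>(j, k). p ^ j * k) ` ({..K} \<times> ?S F)"
  proof
    fix n assume n: "n \<in> ?S (insert p F)"
    obtain j k where nk: "n = p ^ j * k" and k: "\<not> p dvd k"
      using prime_power_canonical[OF p, of n] n by (auto simp: mult.commute)
    have "k > 0" using nk n by (auto intro: Nat.gr0I)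
    have pj: "p ^ j > 0" using p by (simp add: prime_gt_0_nat)
    have "k \<le> K" "p ^ j \<le> K" using nk n pj \<open>k > 0\<close>
      by (auto intro: order_trans[rotated])
    moreover have "j \<le> p ^ j" using prime_gt_1_nat[OF p] by (simp add: less_imp_le power_gt_expt)
    moreover have "prime_factors k \<subseteq> F"
    proof
      fix q assume q: "q \<in> prime_factors k"
      then have "q \<in> prime_factors n" using n nk by (auto simp: in_prime_factors_iff prime_gt_0_nat[OF p])
      then show "q \<in> F" using n q k by (auto simp: in_prime_factors_iff)
    qed
    ultimately show "n \<in> (\<lambda>(j, k). p ^ j * k) ` ({..K} \<times> ?S F)" using nk \<open>k > 0\<close>
      by (auto intro!: image_eqI[of _ _ "(j, k)"])
  qed
  have "(\<Sum>n\<in>?S (insert p F). real n powr (-3/4))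
      \<le> (\<Sum>n\<in>(\<lambda>(j, k). p ^ j * k) ` ({..K} \<times> ?S F). real n powr (-3/4))"
    by (intro sum_mono2 sub finite_imageI finite_cartesian_product fin) auto
  also have "\<dots> \<le> (\<Sum>(j, k)\<in>{..K} \<times> ?S F. real (p ^ j * k) powr (-3/4))"
    by (intro order_trans[OF sum_image_le] finite_cartesian_product fin) (auto simp: case_prod_unfold o_def)
  also have "\<dots> = (\<Sum>j\<le>K. real (p ^ j) powr (-3/4)) * (\<Sum>k\<in>?S F. real k powr (-3/4))"
    by (simp add: sum_product sum.cartesian_product powr_mult)
  also have "\<dots> \<le> exp (3 * real p powr (-3/4)) * exp (3 * (\<Sum>p\<in>F. real p powr (-3/4)))"
    using insert prime_ge_2_nat[OF p] by (intro mult_mono euler_factor_le sum_nonneg) auto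
  also have "\<dots> = exp (3 * (\<Sum>p\<in>insert p F. real p powr (-3/4)))"
    using insert by (simp add: exp_add algebra_simps)
  finally show ?case .
qed

text \<open>With \<open>x\<close> and \<open>y\<close> the fourth roots of \<open>n + 1\<close> and \<open>n\<close>, the increment \<open>4 (x - y)\<close> of the
  right-hand side is at least \<open>1 / x ^ 3\<close>, because \<open>1 = x ^ 4 - y ^ 4 \<le> 4 (x - y) x ^ 3\<close>.\<close>

lemma sum_powr_three_quarters: "(\<Sum>k=1..n. real k powr (-3/4)) \<le> 4 * real n powr (1/4)"
proof (induction n)
  case (Suc n)
  have "real (Suc n) powr (-3/4) \<le> 4 * real (Suc n) powr (1/4) - 4 * real n powr (1/4)"
  proof -
    define x y where "x = real (Suc n) powr (1/4)" and "y = real n powr (1/4)"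
    have xy: "0 \<le> y" "y \<le> x" "x > 0" by (auto simp: x_def y_def powr_mono2)
    have "x ^ 4 = real (Suc n)" "y ^ 4 = real n"
      by (auto simp: x_def y_def powr_powr simp flip: powr_numeral)
    then have "1 = x ^ 4 - y ^ 4" by simp
    also have "\<dots> = (x - y) * (x^3 + x\<^sup>2 * y + x * y\<^sup>2 + y^3)"
      by (simp add: algebra_simps power_numeral_reduce)
    also have "\<dots> \<le> (x - y) * (x^3 + x\<^sup>2 * x + x * x\<^sup>2 + x^3)"
      using xy by (intro mult_left_mono add_mono power_mono) auto
    also have "\<dots> = 4 * (x - y) * x ^ 3" by (simp add: algebra_simps power_numeral_reduce)
    finally have "1 / x ^ 3 \<le> 4 * (x - y)" using xy by (simp add: divide_simps)
    moreover have "real (Suc n) powr (-3/4) = 1 / x ^ 3"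
      by (simp add: x_def powr_powr powr_minus_divide flip: powr_numeral)
    ultimately show ?thesis by (simp add: x_def y_def)
  qed
  then show ?case using Suc by simp
qed simp

definition smooth :: "real \<Rightarrow> nat \<Rightarrow> bool" where
  "smooth R k \<longleftrightarrow> (\<forall>q. prime q \<longrightarrow> q dvd k \<longrightarrow> real q \<le> R)"

text \<open>Rankin's trick: bound the Euler product over the primes up to \<open>R\<close> by extending the sum in the
  exponent to all integers up to \<open>R\<close>. The exponent \<open>3/4\<close> is chosen such that for \<open>R = L ^ 3\<close>
  the bound is \<open>exp (12 L^(3/4))\<close>, which is smaller than a quarter power of \<open>exp (L^(4/5))\<close>.\<close>

lemma sum_smooth_le:
  assumes "R \<ge> 0"
  shows "(\<Sum>k | k \<in> {1..K} \<and> smooth R k. real k powr (-3/4)) \<le> exp (12 * R powr (1/4))"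
proof -
  define r where "r = nat \<lfloor>R\<rfloor>"
  define F where "F = {p \<in> {1..r}. prime p}"
  have le_r: "q \<le> r" if "real q \<le> R" for q using that assms by (simp add: r_def le_nat_floor)
  have "{k. k \<in> {1..K} \<and> smooth R k} \<subseteq> {k. k \<in> {1..K} \<and> prime_factors k \<subseteq> F}"
    by (auto simp: smooth_def F_def in_prime_factors_iff intro!: le_r prime_ge_Suc_0_nat)
  then have "(\<Sum>k | k \<in> {1..K} \<and> smooth R k. real k powr (-3/4))
      \<le> (\<Sum>k | k \<in> {1..K} \<and> prime_factors k \<subseteq> F. real k powr (-3/4))"
    by (intro sum_mono2) auto
  also have "\<dots> \<le> exp (3 * (\<Sum>p\<in>F. real p powr (-3/4)))"
    by (rule sum_over_prime_set_le) (auto simp: F_def)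
  also have "(\<Sum>p\<in>F. real p powr (-3/4)) \<le> (\<Sum>p=1..r. real p powr (-3/4))"
    by (intro sum_mono2) (auto simp: F_def)
  also have "\<dots> \<le> 4 * real r powr (1/4)" by (rule sum_powr_three_quarters)
  also have "real r powr (1/4) \<le> R powr (1/4)"
    using assms by (intro powr_mono2) (auto simp: r_def)
  finally show ?thesis by simp
qed

section \<open>Typical integers\<close>

text \<open>The parameters are powers of \<open>L = ln N\<close> whose exponents are tied together. The threshold \<open>L^3\<close>
  must beat the factor \<open>L^2\<close> lost to harmonic sums in the final count. Rankin's bound for
  \<open>L^3\<close>-smooth integers costs \<open>exp (12 L^(3/4))\<close>, so only primes above \<open>exp (L^(4/5))\<close> can be
  expected to have a shift that is not smooth. For the cofactor of the largest prime to contain such a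
  prime, it must be larger than the part composed of smaller primes, whose logarithm is
  \<open>O(L^(4/5))\<close> on average; this is where the margin \<open>L^(9/10)\<close> comes from. The last condition
  excludes large primes \<open>p\<close> that divide both \<open>n\<close> and \<open>s n\<close>.\<close>

definition typical :: "nat \<Rightarrow> nat \<Rightarrow> bool" where
  "typical N n \<longleftrightarrow> (let L = ln (real N) in
     (\<forall>d. d\<^sup>2 dvd n \<longrightarrow> real d \<le> L / 2) \<and>
     (\<forall>p. prime p \<longrightarrow> p dvd n \<longrightarrow> real p \<le> exp (L - L powr (9/10))) \<and>
     real n \<ge> real N / L \<and>
     smooth_part_ln (exp (L powr (4/5))) n < L powr (9/10) - ln L \<and>
     (\<forall>p. prime p \<longrightarrow> p dvd n \<longrightarrow> real p > exp (L powr (4/5)) \<longrightarrow> \<not> smooth (L ^ 3) (p + 1)) \<and>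
     (\<forall>p q. prime p \<longrightarrow> prime q \<longrightarrow> real p > L ^ 3 / 2 \<longrightarrow> p dvd q + 1 \<longrightarrow> \<not> p * q dvd n))"

lemma card_square_multiples:
  assumes "D > 0"
  shows "real (card {n \<in> {1..N}. \<exists>d. real d > D \<and> d\<^sup>2 dvd n}) \<le> real N * (2 / D)"
proof -
  define I where "I = {d \<in> {1..N}. real d > D}"
  have "{n \<in> {1..N}. \<exists>d. real d > D \<and> d\<^sup>2 dvd n} = {n \<in> {1..N}. \<exists>d\<in>I. d\<^sup>2 dvd n}"
  proof (intro Collect_cong conj_cong refl iffI)
    fix n assume n: "n \<in> {1..N}" "\<exists>d. real d > D \<and> d\<^sup>2 dvd n"
    then obtain d where d: "real d > D" "d\<^sup>2 dvd n" by blast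
    have "d \<le> d\<^sup>2" by (simp add: power2_eq_square)
    also have "\<dots> \<le> n" using d n by (intro dvd_imp_le) auto
    finally have "d \<in> I" using d n assms by (auto simp: I_def intro: Suc_leI Nat.gr0I)
    then show "\<exists>d\<in>I. d\<^sup>2 dvd n" using d by blast
  qed (auto simp: I_def)
  also have "real (card \<dots>) \<le> real N * (\<Sum>d\<in>I. 1 / real (d\<^sup>2))"
    by (rule card_multiples_of_some) (auto simp: I_def)
  also have "\<dots> \<le> real N * (2 / D)"
    unfolding of_nat_power
    by (intro mult_left_mono sum_inverse_squares_tail assms) (auto simp: I_def)
  finally show ?thesis .
qed

text \<open>For primes above \<open>B\<close> the weight \<open>1 / p\<close> is at most \<open>(ln p / p) / ln B\<close>. If \<open>ln B\<close> is close
  to \<open>ln N\<close>, then \<open>ln (N / B)\<close> is small compared with \<open>ln B\<close>: hardly any integer has a prime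
  factor of almost its own size.\<close>

lemma card_large_prime_multiples:
  assumes "1 < B" "B \<le> real N"
  shows "real (card {n \<in> {1..N}. \<exists>p. prime p \<and> real p > B \<and> p dvd n})
           \<le> real N * ((2 * ln (real N / B) + 4) / ln B)"
proof -
  define I where "I = {p. prime p \<and> B < real p \<and> real p \<le> real N}"
  have fin: "finite I" by (rule finite_subset[of _ "{..N}"]) (auto simp: I_def)
  have "{n \<in> {1..N}. \<exists>p. prime p \<and> real p > B \<and> p dvd n} = {n \<in> {1..N}. \<exists>p\<in>I. p dvd n}"
  proof (intro Collect_cong conj_cong refl)
    fix n assume n: "n \<in> {1..N}"
    then have "p \<le> N" if "p dvd n" for p using dvd_imp_le[OF that] by simp
    then show "(\<exists>p. prime p \<and> real p > B \<and> p dvd n) = (\<exists>p\<in>I. p dvd n)"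
      unfolding I_def by (simp only: of_nat_le_iff mem_Collect_eq Bex_def) blast
  qed
  also have "real (card \<dots>) \<le> real N * (\<Sum>p\<in>I. 1 / real p)"
    by (rule card_multiples_of_some[OF fin]) (auto simp: I_def prime_gt_0_nat)
  also have "(\<Sum>p\<in>I. 1 / real p) \<le> (\<Sum>p\<in>I. ln (real p) / real p / ln B)"
  proof (rule sum_mono)
    fix p assume "p \<in> I"
    then have "ln B \<le> ln (real p)" "real p > 0" using assms by (auto simp: I_def)
    moreover have "ln B > 0" using assms by simp
    ultimately show "1 / real p \<le> ln (real p) / real p / ln B" by (simp add: field_simps)
  qed
  also have "\<dots> = (\<Sum>p\<in>I. ln (real p) / real p) / ln B" by (simp add: sum_divide_distrib)
  also have "\<dots> \<le> (2 * ln (real N / B) + 4) / ln B"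
    using assms unfolding I_def by (intro divide_right_mono sum_primes_ln_div_le) auto
  finally show ?thesis by (simp add: mult_left_mono)
qed

lemma card_large_smooth_part:
  assumes "A \<ge> 1" "t > 0"
  shows "real (card {n \<in> {1..N}. smooth_part_ln A n \<ge> t}) \<le> real N * (2 * (2 * ln A + 4) / t)"
proof -
  have "real (card {n \<in> {1..N}. smooth_part_ln A n \<ge> t}) \<le> (\<Sum>n\<in>{1..N}. smooth_part_ln A n) / t"
    by (intro card_ge_le_sum_div smooth_part_ln_nonneg assms) auto
  also have "\<dots> \<le> 2 * real N * (2 * ln A + 4) / t"
    using assms by (intro divide_right_mono sum_smooth_part_ln_le) auto
  finally show ?thesis by (simp add: mult_ac)
qed

text \<open>In the sum of \<open>1 / p\<close>, split \<open>1 / (p + 1)\<close> into \<open>(p + 1) powr (-1/4) \<le> A powr (-1/4)\<close> and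
  \<open>(p + 1) powr (-3/4)\<close>, and apply Rankin's bound to the latter.
  The sum is extended to all integers \<open>p\<close> for which \<open>p + 1\<close> is smooth.\<close>

lemma card_smooth_shift_multiples:
  assumes "A > 0" "R \<ge> 0"
  shows "real (card {n \<in> {1..N}. \<exists>p. prime p \<and> p dvd n \<and> real p > A \<and> smooth R (p + 1)})
           \<le> real N * (2 * A powr (-1/4) * exp (12 * R powr (1/4)))"
proof -
  define I where "I = {p \<in> {1..N}. real p > A \<and> smooth R (p + 1)}"
  have "{n \<in> {1..N}. \<exists>p. prime p \<and> p dvd n \<and> real p > A \<and> smooth R (p + 1)}
      \<subseteq> {n \<in> {1..N}. \<exists>p\<in>I. p dvd n}"
  proof
    fix n assume "n \<in> {n \<in> {1..N}. \<exists>p. prime p \<and> p dvd n \<and> real p > A \<and> smooth R (p + 1)}"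
    then obtain p where n: "n \<in> {1..N}" and p: "prime p" "p dvd n" "real p > A" "smooth R (p + 1)"
      by blast
    have "p \<le> n" using p n by (intro dvd_imp_le) auto
    then have "p \<in> I" using p n by (simp add: I_def prime_ge_Suc_0_nat)
    then show "n \<in> {n \<in> {1..N}. \<exists>p\<in>I. p dvd n}" using n p by blast
  qed
  then have "real (card {n \<in> {1..N}. \<exists>p. prime p \<and> p dvd n \<and> real p > A \<and> smooth R (p + 1)})
      \<le> real (card {n \<in> {1..N}. \<exists>p\<in>I. p dvd n})"
    by (intro of_nat_mono card_mono) auto
  also have "\<dots> \<le> real N * (\<Sum>p\<in>I. 1 / real p)"
    by (rule card_multiples_of_some) (auto simp: I_def)
  also have "(\<Sum>p\<in>I. 1 / real p) \<le> (\<Sum>p\<in>I. 2 * A powr (-1/4) * real (p + 1) powr (-3/4))"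
  proof (rule sum_mono)
    fix p assume p: "p \<in> I"
    have "1 / real p \<le> 2 * (1 / real (p + 1))" using p by (simp add: I_def field_simps)
    also have "1 / real (p + 1) = real (p + 1) powr (-1/4) * real (p + 1) powr (-3/4)"
      by (simp add: powr_minus_divide flip: powr_add)
    also have "\<dots> \<le> A powr (-1/4) * real (p + 1) powr (-3/4)"
      using p assms by (intro mult_right_mono powr_mono2') (auto simp: I_def)
    finally show "1 / real p \<le> 2 * A powr (-1/4) * real (p + 1) powr (-3/4)" by simp
  qed
  also have "\<dots> = 2 * A powr (-1/4) * (\<Sum>k\<in>Suc ` I. real k powr (-3/4))"
    by (simp add: sum_distrib_left sum.reindex)
  also have "(\<Sum>k\<in>Suc ` I. real k powr (-3/4))
      \<le> (\<Sum>k | k \<in> {1..Suc N} \<and> smooth R k. real k powr (-3/4))"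
    by (intro sum_mono2) (auto simp: I_def)
  also have "\<dots> \<le> exp (12 * R powr (1/4))" by (rule sum_smooth_le[OF assms(2)])
  finally show ?thesis by (simp add: mult_left_mono)
qed

text \<open>Sum \<open>1 / (p q)\<close> over all \<open>q\<close> with \<open>q = -1\<close> modulo \<open>p\<close>, then over \<open>p > T\<close>. The first sum
  produces a second factor \<open>1 / p\<close>, so that the outer sum converges with tail \<open>O(1 / T)\<close>.\<close>

lemma card_prime_chain_multiples:
  assumes "T \<ge> 1" "N > 0"
  shows "real (card {n \<in> {1..N}. \<exists>p q. real p > T \<and> p dvd q + 1 \<and> p * q dvd n})
           \<le> real N * (4 * (1 + ln (real N)) / T)"
proof -
  define P where "P = {p \<in> {1..N}. real p > T}"
  define I where "I = (SIGMA p:P. {q \<in> {1..N}. p dvd q + 1})"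
  define L where "L = ln (real N)"
  have L: "L \<ge> 0" using assms by (simp add: L_def)
  have fin: "finite P" "finite I" by (auto simp: P_def I_def)
  have "{n \<in> {1..N}. \<exists>p q. real p > T \<and> p dvd q + 1 \<and> p * q dvd n}
      \<subseteq> {n \<in> {1..N}. \<exists>i\<in>I. fst i * snd i dvd n}"
  proof clarsimp
    fix n p q assume n: "Suc 0 \<le> n" "n \<le> N" and pq: "real p > T" "p dvd Suc q" "p * q dvd n"
    have "p dvd n" "q dvd n" using pq(3) by (auto dest: dvd_mult_left dvd_mult_right)
    then have "p \<le> n" "q \<le> n" "p > 0" "q > 0" using n by (auto dest: dvd_imp_le intro!: Nat.gr0I)
    then have "(p, q) \<in> I" using n pq by (auto simp: I_def P_def)
    then show "\<exists>i\<in>I. fst i * snd i dvd n" using pq(3) by (intro bexI[of _ "(p, q)"]) auto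
  qed
  then have "real (card {n \<in> {1..N}. \<exists>p q. real p > T \<and> p dvd q + 1 \<and> p * q dvd n})
      \<le> real (card {n \<in> {1..N}. \<exists>i\<in>I. fst i * snd i dvd n})"
    by (intro of_nat_mono card_mono) auto
  also have "\<dots> \<le> real N * (\<Sum>i\<in>I. 1 / real (fst i * snd i))"
    by (rule card_multiples_of_some[OF fin(2)]) (auto simp: I_def P_def)
  also have "(\<Sum>i\<in>I. 1 / real (fst i * snd i)) = (\<Sum>p\<in>P. \<Sum>q | q \<in> {1..N} \<and> p dvd q + 1. 1 / (real p * real q))"
    unfolding I_def by (subst sum.Sigma[OF fin(1)]) (auto simp: case_prod_unfold)
  also have "\<dots> = (\<Sum>p\<in>P. 1 / real p * (\<Sum>q | q \<in> {1..N} \<and> p dvd q + 1. 1 / real q))"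
    by (simp add: sum_distrib_left)
  also have "\<dots> \<le> (\<Sum>p\<in>P. 1 / real p * (2 * (1 + L) / real p))"
    unfolding L_def
  proof (intro sum_mono mult_left_mono sum_inverse_class_le)
    fix p assume "p \<in> P"
    then have "real p > 1" using assms by (simp add: P_def)
    then show "2 \<le> p" by simp
  qed auto
  also have "\<dots> = 2 * (1 + L) * (\<Sum>p\<in>P. 1 / (real p)\<^sup>2)"
    by (simp add: sum_distrib_left power2_eq_square mult.commute)
  also have "\<dots> \<le> 2 * (1 + L) * (2 / T)"
    using L assms by (intro mult_left_mono sum_inverse_squares_tail fin) (auto simp: P_def)
  finally show ?thesis by (simp add: mult_left_mono L_def)
qed

definition atypical_bound :: "real \<Rightarrow> real" where
  "atypical_bound L = 4 / L + (2 * L powr (9/10) + 4) / (L - L powr (9/10)) + 1 / L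
     + 2 * (2 * L powr (4/5) + 4) / (L powr (9/10) - ln L)
     + 2 * exp (12 * (L ^ 3) powr (1/4) - L powr (4/5) / 4)
     + 8 * (1 + L) / L ^ 3"

text \<open>Each of the six conditions in \<open>typical\<close> fails rarely; the summands of \<open>atypical_bound\<close> come
  in the same order as the conditions.\<close>

lemma card_atypical_le:
  assumes L: "L = ln (real N)" "L \<ge> 2" "L powr (9/10) - ln L > 0"
  shows "real (card {n \<in> {1..N}. \<not> typical N n}) \<le> real N * atypical_bound L"
proof -
  define B where "B = exp (L - L powr (9/10))"
  define A where "A = exp (L powr (4/5))"
  have N: "real N > 0" using L by (cases "N = 0") auto
  have L0: "L > 0" using L by simp
  have "L powr (9/10) < L powr 1" using L by (intro powr_less_mono) auto
  then have LB: "L powr (9/10) < L" using L0 by simp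
  have B: "1 < B" "B \<le> real N" "ln B = L - L powr (9/10)" "ln (real N / B) = L powr (9/10)"
  proof -
    show "1 < B" "ln B = L - L powr (9/10)" using LB by (auto simp: B_def)
    have "B \<le> exp L" by (simp add: B_def)
    then show "B \<le> real N" using L N by simp
    show "ln (real N / B) = L powr (9/10)" using N L by (simp add: ln_div B_def)
  qed
  have A: "A \<ge> 1" "A > 0" "ln A = L powr (4/5)" "A powr (-1/4) = exp (- (L powr (4/5) / 4))"
    by (auto simp: A_def powr_def)
  define E1 where "E1 = {n \<in> {1..N}. \<exists>d. real d > L / 2 \<and> d\<^sup>2 dvd n}"
  define E2 where "E2 = {n \<in> {1..N}. \<exists>p. prime p \<and> real p > B \<and> p dvd n}"
  define E3 where "E3 = {n \<in> {1..N}. real n < real N / L}"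
  define E4 where "E4 = {n \<in> {1..N}. smooth_part_ln A n \<ge> L powr (9/10) - ln L}"
  define E5 where "E5 = {n \<in> {1..N}. \<exists>p. prime p \<and> p dvd n \<and> real p > A \<and> smooth (L ^ 3) (p + 1)}"
  define E6 where "E6 = {n \<in> {1..N}. \<exists>p q. real p > L ^ 3 / 2 \<and> p dvd q + 1 \<and> p * q dvd n}"
  note E_defs = E1_def E2_def E3_def E4_def E5_def E6_def
  have sub: "{n \<in> {1..N}. \<not> typical N n} \<subseteq> E1 \<union> (E2 \<union> (E3 \<union> (E4 \<union> (E5 \<union> E6))))"
    unfolding typical_def Let_def E_defs A_def B_def L(1)[symmetric] by (auto simp: not_le not_less)
  have fin: "finite E1" "finite E2" "finite E3" "finite E4" "finite E5" "finite E6"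
    by (simp_all add: E_defs)
  have "card {n \<in> {1..N}. \<not> typical N n} \<le> card (E1 \<union> (E2 \<union> (E3 \<union> (E4 \<union> (E5 \<union> E6)))))"
    by (intro card_mono sub) (use fin in auto)
  also have "\<dots> \<le> card E1 + (card E2 + (card E3 + (card E4 + (card E5 + card E6))))"
    by (intro order_trans[OF card_Un_le] add_left_mono) simp
  finally have "real (card {n \<in> {1..N}. \<not> typical N n})
      \<le> real (card E1) + real (card E2) + real (card E3) + real (card E4) + real (card E5) + real (card E6)"
    by linarith
  moreover have "real (card E1) \<le> real N * (4 / L)"
    using card_square_multiples[of "L / 2" N] L0 by (simp add: E1_def)
  moreover have "real (card E2) \<le> real N * ((2 * L powr (9/10) + 4) / (L - L powr (9/10)))"
    using card_large_prime_multiples[OF B(1,2)] by (simp add: E2_def B)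
  moreover have "real (card E3) \<le> real N * (1 / L)"
  proof -
    have "E3 \<subseteq> {1..nat \<lfloor>real N / L\<rfloor>}"
    proof
      fix n assume "n \<in> E3"
      then have "1 \<le> n" "real n \<le> real N / L" by (simp_all add: E3_def)
      then show "n \<in> {1..nat \<lfloor>real N / L\<rfloor>}" by (simp add: le_nat_floor)
    qed
    then have "card E3 \<le> card {1..nat \<lfloor>real N / L\<rfloor>}" by (intro card_mono) auto
    then have "real (card E3) \<le> real (nat \<lfloor>real N / L\<rfloor>)" by simp
    also have "\<dots> \<le> real N / L" using L0 N by simp
    finally show ?thesis by simp
  qed
  moreover have "real (card E4) \<le> real N * (2 * (2 * L powr (4/5) + 4) / (L powr (9/10) - ln L))"
    using card_large_smooth_part[OF A(1) L(3), of N] by (simp only: E4_def A)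
  moreover have "real (card E5) \<le> real N * (2 * exp (12 * (L ^ 3) powr (1/4) - L powr (4/5) / 4))"
  proof -
    have "real (card E5) \<le> real N * (2 * A powr (-1/4) * exp (12 * (L ^ 3) powr (1/4)))"
      unfolding E5_def using A L0 by (intro card_smooth_shift_multiples) auto
    also have "2 * A powr (-1/4) * exp (12 * (L ^ 3) powr (1/4))
        = 2 * exp (12 * (L ^ 3) powr (1/4) - L powr (4/5) / 4)"
      by (simp only: A diff_conv_add_uminus exp_add mult_ac)
    finally show ?thesis .
  qed
  moreover have "real (card E6) \<le> real N * (8 * (1 + L) / L ^ 3)"
  proof -
    have "2 ^ 3 \<le> L ^ 3" using L(2) by (intro power_mono) auto
    then have "L ^ 3 / 2 \<ge> 1" by simp
    from card_prime_chain_multiples[OF this, of N] show ?thesis using N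
      by (simp add: E6_def flip: L(1))
  qed
  ultimately show ?thesis unfolding atypical_bound_def distrib_left by linarith
qed

definition largest_prime :: "nat \<Rightarrow> nat" where
  "largest_prime n = Max (prime_factors n)"

lemma largest_prime:
  assumes "n > 1"
  shows "prime (largest_prime n)" "largest_prime n dvd n"
    "\<And>p. prime p \<Longrightarrow> p dvd n \<Longrightarrow> p \<le> largest_prime n"
proof -
  have "prime_factors n \<noteq> {}" using assms by (auto simp: prime_factorization_empty_iff)
  then have "largest_prime n \<in> prime_factors n" unfolding largest_prime_def by (intro Max_in) auto
  then show "prime (largest_prime n)" "largest_prime n dvd n" by (auto simp: in_prime_factors_iff)
  show "p \<le> largest_prime n" if "prime p" "p dvd n" for p
    unfolding largest_prime_def using that assms by (intro Max_ge) (auto simp: in_prime_factors_iff)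
qed

text \<open>In the alternative offered by \<open>prime_dvd_divisor_sigma\<close>, a square \<open>d^2\<close> dividing \<open>n\<close> would
  satisfy \<open>L^3 / 2 < q < 2 d^3\<close>, contradicting \<open>d \<le> L / 2\<close>.\<close>

lemma typical_prime_dvd_divisor_sigma:
  assumes "typical N n" "n > 0" "prime q" "q dvd divisor_sigma n" "real q > ln (real N) ^ 3 / 2"
  shows "\<exists>p. prime p \<and> p dvd n \<and> q dvd p + 1"
proof (rule ccontr)
  define L where "L = ln (real N)"
  assume "\<not> ?thesis"
  then obtain d where d: "d\<^sup>2 dvd n" "q < 2 * d ^ 3"
    using prime_dvd_divisor_sigma[OF assms(3,2,4)] by blast
  have "real d \<le> L / 2" using assms(1) d(1) by (simp add: typical_def Let_def L_def)
  then have "real d ^ 3 \<le> (L / 2) ^ 3" by (intro power_mono) auto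
  also have "(L / 2) ^ 3 = L ^ 3 / 8" by (simp add: power_divide)
  finally have d3: "real d ^ 3 \<le> L ^ 3 / 8" .
  have "real q < real (2 * d ^ 3)" using d(2) by (simp only: of_nat_less_iff)
  then have "real q < 2 * real d ^ 3" by simp
  moreover have "real q \<ge> 0" "real q > L ^ 3 / 2" using assms(5) by (simp_all add: L_def)
  ultimately show False using d3 by linarith
qed

text \<open>If the cofactor \<open>l\<close> of the largest prime were composed of primes up to \<open>A = exp (L^(4/5))\<close>,
  then \<open>ln l = ln n - ln Q \<ge> (L - ln L) - (L - L^(9/10))\<close>, which exceeds what the smooth part of a
  typical integer allows. So a prime \<open>q > A\<close> divides \<open>l\<close>. Since squares of numbers above \<open>L / 2\<close>
  do not divide \<open>n\<close>, neither \<open>q\<close> nor \<open>Q \<ge> q\<close> divides \<open>n\<close> twice, and \<open>q + 1\<close> divides \<open>s l\<close>.\<close>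

lemma typical_cofactor:
  assumes "typical N n" "1 < n" "n \<le> N" "ln (real N) > 1" "exp (ln (real N) powr (4/5)) \<ge> ln (real N) / 2"
  obtains l r where "n = largest_prime n * l" "\<not> largest_prime n dvd l"
    "prime r" "real r > ln (real N) ^ 3" "r dvd divisor_sigma l"
proof -
  define L where "L = ln (real N)"
  define A where "A = exp (L powr (4/5))"
  define Q where "Q = largest_prime n"
  note Q = largest_prime[OF assms(2), folded Q_def]
  have L: "L > 1" using assms(4) by (simp add: L_def)
  have typic: "\<And>d. d\<^sup>2 dvd n \<Longrightarrow> real d \<le> L / 2"
      "\<And>p. prime p \<Longrightarrow> p dvd n \<Longrightarrow> real p \<le> exp (L - L powr (9/10))"
      "real n \<ge> real N / L" "smooth_part_ln A n < L powr (9/10) - ln L"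
      "\<And>p. prime p \<Longrightarrow> p dvd n \<Longrightarrow> real p > A \<Longrightarrow> \<not> smooth (L ^ 3) (p + 1)"
    using assms(1) by (auto simp: typical_def Let_def L_def A_def)
  obtain l where l: "n = Q * l" using Q(2) by blast
  then have ln: "l dvd n" by simp
  have l0: "l > 0" using l assms(2) by (auto intro: Nat.gr0I)
  have "\<exists>q. prime q \<and> q dvd l \<and> real q > A"
  proof (rule ccontr)
    assume "\<not> ?thesis"
    then have "ln (real l) \<le> smooth_part_ln A n"
      using ln assms(2) by (intro ln_smooth_divisor_le) (auto simp: not_less)
    moreover have "ln (real n) = ln (real Q) + ln (real l)"
      using l0 prime_gt_0_nat[OF Q(1)] by (simp add: l ln_mult)
    moreover have "ln (real Q) \<le> L - L powr (9/10)"
      using typic(2)[OF Q(1,2)] prime_gt_0_nat[OF Q(1)] ln_le_cancel_iff[of "real Q" "exp (L - L powr (9/10))"]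
      by simp
    moreover have "ln (real N / L) \<le> ln (real n)"
      using typic(3) L assms by (intro ln_mono) auto
    moreover have "ln (real N / L) = L - ln L" using L assms by (simp add: ln_div L_def)
    ultimately show False using typic(4) by linarith
  qed
  then obtain q where q: "prime q" "q dvd l" "real q > A" by blast
  have AL: "A \<ge> L / 2" using assms(5) by (simp add: A_def L_def)
  have simple: "\<not> p\<^sup>2 dvd n" if "p \<ge> q" for p
  proof
    assume "p\<^sup>2 dvd n"
    from typic(1)[OF this] show False using that q(3) AL by linarith
  qed
  have "q dvd n" using q(2) l by simp
  then have "q \<le> Q" using Q(3) q(1) by blast
  then have Ql: "\<not> Q dvd l"
    using simple[of Q] l by (auto simp: power2_eq_square)
  obtain k where k: "l = q * k" using q(2) by blast
  have "\<not> q dvd k"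
    using simple[of q] l k by (auto simp: power2_eq_square)
  then have "coprime q k" using q(1) by (simp add: prime_imp_coprime)
  then have "divisor_sigma l = (q + 1) * divisor_sigma k"
    by (simp add: k divisor_sigma_mult_coprime divisor_sigma_prime[OF q(1)])
  moreover have "\<not> smooth (L ^ 3) (q + 1)" using typic(5) q \<open>q dvd n\<close> by blast
  then obtain r where r: "prime r" "r dvd q + 1" "real r > L ^ 3" by (auto simp: smooth_def not_le)
  ultimately have "r dvd divisor_sigma l" by (metis dvd_mult2)
  with l Ql r(1,3) show ?thesis unfolding Q_def L_def by (rule that[of l r])
qed

section \<open>Pairs whose second member has the larger largest prime factor\<close>

text \<open>Counts the integers \<open>n = Q l\<close> for which \<open>Q\<close> solves a nondegenerate linear congruence modulo a
  prime \<open>p = -1\<close> modulo \<open>r l\<close>. Each pair \<open>l, p\<close> leaves at most \<open>N / (l p) + 1\<close> values of \<open>Q\<close>, and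
  the requirement \<open>p \<le> Q \<le> N / l\<close> absorbs the \<open>+ 1\<close>. It matters that \<open>r\<close> is a function of
  \<open>l\<close>: no sum over \<open>r\<close> arises.\<close>

lemma card_linear_congruence_le:
  fixes r :: "nat \<Rightarrow> nat" and c e :: "nat \<Rightarrow> int"
  assumes "N > 0" "R \<ge> 2" "I \<subseteq> {1..N}" "\<And>l. l \<in> I \<Longrightarrow> real (r l) \<ge> R"
  shows "real (card {n. \<exists>l\<in>I. \<exists>p Q. n = Q * l \<and> n \<le> N \<and> prime p \<and> r l dvd p + 1 \<and> p \<le> Q \<and>
            \<not> int p dvd c l \<and> int p dvd int Q * c l + e l})
           \<le> real N * (4 * (1 + ln (real N))\<^sup>2 / R)"
proof -
  define P where "P l = {p. p \<in> {1..N} \<and> r l dvd p + 1}" for l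
  define S where "S l p = {Q \<in> {p..N div l}. prime p \<and> \<not> int p dvd c l \<and> int p dvd int Q * c l + e l}" for l p
  define L where "L = ln (real N)"
  have L: "L \<ge> 0" using assms by (simp add: L_def)
  have finI: "finite I" using assms(3) finite_subset by blast
  have finP: "finite (P l)" for l by (simp add: P_def)
  let ?T = "{n. \<exists>l\<in>I. \<exists>p Q. n = Q * l \<and> n \<le> N \<and> prime p \<and> r l dvd p + 1 \<and> p \<le> Q \<and>
            \<not> int p dvd c l \<and> int p dvd int Q * c l + e l}"
  have sub: "?T \<subseteq> (\<Union>l\<in>I. \<Union>p\<in>P l. (\<lambda>Q. Q * l) ` S l p)"
  proof
    fix n assume "n \<in> ?T"
    then obtain l p Q where *: "l \<in> I" "n = Q * l" "n \<le> N" "prime p" "r l dvd p + 1" "p \<le> Q"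
        "\<not> int p dvd c l" "int p dvd int Q * c l + e l" by blast
    have "l > 0" using *(1) assms(3) by auto
    then have "Q \<le> N div l" using * by (simp add: less_eq_div_iff_mult_less_eq)
    then have "Q \<in> S l p" using * by (simp add: S_def)
    moreover have "p \<le> N" using \<open>Q \<le> N div l\<close> *(6) by (meson div_le_dividend order_trans)
    then have "p \<in> P l" using * by (simp add: P_def prime_ge_Suc_0_nat)
    ultimately show "n \<in> (\<Union>l\<in>I. \<Union>p\<in>P l. (\<lambda>Q. Q * l) ` S l p)" using * by blast
  qed
  have cardS: "real (card (S l p)) \<le> 2 * real N / real l * (1 / real p)" if "l \<in> I" "p \<in> P l" for l p
  proof (cases "S l p = {}")
    case False
    then have p: "prime p" "\<not> int p dvd c l" "p \<le> N div l" by (auto simp: S_def)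
    have pos: "p > 0" "l > 0" using that assms(3) by (auto simp: P_def)
    \<comment> \<open>Two solutions differ by a multiple of \<open>p\<close> since \<open>c l\<close> is invertible modulo \<open>p\<close>.\<close>
    have "real (card (S l p)) \<le> real (N div l) / real p + 1"
    proof (rule card_residue_class)
      fix u v assume "u \<in> S l p" "v \<in> S l p"
      then have "int p dvd (int u * c l + e l) - (int v * c l + e l)"
        by (intro dvd_diff) (auto simp: S_def)
      then have "int p dvd (int u - int v) * c l" by (simp add: algebra_simps)
      then have "int p dvd int u - int v" using p by (simp add: prime_dvd_mult_iff)
      then have "int u mod int p = int v mod int p" by (simp add: mod_eq_dvd_iff)
      then show "u mod p = v mod p" by (simp flip: zmod_int)
    qed (use pos in \<open>auto simp: S_def\<close>)
    also have "1 \<le> real (N div l) / real p" using p(3) pos by simp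
    also have "real (N div l) / real p + real (N div l) / real p = 2 * real (N div l) * (1 / real p)" by simp
    also have "\<dots> \<le> 2 * (real N / real l) * (1 / real p)"
      by (intro mult_right_mono mult_left_mono of_nat_div_le_of_nat) auto
    finally show ?thesis by simp
  qed auto
  have inner: "(\<Sum>p\<in>P l. 2 * real N / real l * (1 / real p)) \<le> real N * (4 * (1 + L) / R) * (1 / real l)"
    if "l \<in> I" for l
  proof -
    have r: "real (r l) \<ge> R" using assms(4) that by blast
    then have "real (r l) \<ge> 2" using assms(2) by linarith
    then have "r l \<ge> 2" by simp
    have "(\<Sum>p\<in>P l. 2 * real N / real l * (1 / real p)) = 2 * real N / real l * (\<Sum>p\<in>P l. 1 / real p)"
      by (simp add: sum_distrib_left)
    also have "\<dots> \<le> 2 * real N / real l * (2 * (1 + L) / real (r l))"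
      unfolding P_def L_def by (intro mult_left_mono sum_inverse_class_le \<open>r l \<ge> 2\<close>) auto
    also have "\<dots> \<le> 2 * real N / real l * (2 * (1 + L) / R)"
      using r assms(2) L by (intro mult_left_mono divide_left_mono) auto
    finally show ?thesis by (simp add: mult_ac)
  qed
  have "card ?T \<le> card (\<Union>l\<in>I. \<Union>p\<in>P l. (\<lambda>Q. Q * l) ` S l p)"
    by (intro card_mono sub finite_UN_I finI finP) (auto simp: S_def)
  also have "\<dots> \<le> (\<Sum>l\<in>I. card (\<Union>p\<in>P l. (\<lambda>Q. Q * l) ` S l p))" by (rule card_UN_le[OF finI])
  also have "\<dots> \<le> (\<Sum>l\<in>I. \<Sum>p\<in>P l. card ((\<lambda>Q. Q * l) ` S l p))"
    by (intro sum_mono card_UN_le finP)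
  also have "\<dots> \<le> (\<Sum>l\<in>I. \<Sum>p\<in>P l. card (S l p))"
    by (intro sum_mono card_image_le) (auto simp: S_def)
  finally have "real (card ?T) \<le> (\<Sum>l\<in>I. \<Sum>p\<in>P l. real (card (S l p)))"
    by (simp only: of_nat_le_iff flip: of_nat_sum)
  also have "\<dots> \<le> (\<Sum>l\<in>I. \<Sum>p\<in>P l. 2 * real N / real l * (1 / real p))"
    by (intro sum_mono cardS)
  also have "\<dots> \<le> (\<Sum>l\<in>I. real N * (4 * (1 + L) / R) * (1 / real l))" by (intro sum_mono inner)
  also have "\<dots> = real N * (4 * (1 + L) / R) * (\<Sum>l\<in>I. 1 / real l)" by (simp add: sum_distrib_left)
  also have "\<dots> \<le> real N * (4 * (1 + L) / R) * (1 + L)"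
  proof (rule mult_left_mono)
    have "(\<Sum>l\<in>I. 1 / real l) \<le> (\<Sum>l=1..N. 1 / real l)" by (intro sum_mono2 assms) auto
    also have "\<dots> \<le> 1 + L" unfolding L_def using assms by (intro sum_inverse_le_ln)
    finally show "(\<Sum>l\<in>I. 1 / real l) \<le> 1 + L" .
  qed (use L assms in auto)
  also have "\<dots> = real N * (4 * (1 + L)\<^sup>2 / R)"
    by (simp only: power2_eq_square times_divide_eq_left times_divide_eq_right mult_ac)
  finally show ?thesis unfolding L_def .
qed

text \<open>No order between \<open>m\<close> and \<open>n\<close> themselves is imposed, so that exchanging the members together
  with the coefficients covers the pairs whose first member has the larger largest prime.\<close>

definition ordered_pairs :: "nat \<Rightarrow> nat \<Rightarrow> nat \<Rightarrow> (nat \<times> nat) set" where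
  "ordered_pairs a b N = {(m, n). m \<in> {1..N} \<and> n \<in> {1..N} \<and> multiamicable a b m n \<and>
     largest_prime m \<le> largest_prime n}"

text \<open>The congruence expresses that \<open>p\<close> divides \<open>a m\<close>. It is nondegenerate: otherwise \<open>p\<close> would
  divide \<open>s l\<close> and \<open>b l\<close>, hence \<open>l\<close>, as \<open>p > b\<close>. But then \<open>p\<close> divides both \<open>n\<close> and \<open>s n\<close>, so
  that \<open>n\<close> is divisible by \<open>p q\<close> for a prime \<open>q = -1\<close> modulo \<open>p\<close>, which the last condition on
  typical integers forbids.\<close>

lemma typical_pair_congruence:
  assumes ab: "a > 0" "b > 0" and pair: "(m, n) \<in> ordered_pairs a b N"
    and typic: "typical N m" "typical N n"
    and n: "n = Q * l" "Q = largest_prime n" "\<not> Q dvd l"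
    and r: "prime r" "real r > L ^ 3" "r dvd divisor_sigma l"
    and L: "L = ln (real N)" "L \<ge> 2" "L ^ 3 \<ge> 2 * real b"
  shows "\<exists>p. prime p \<and> r dvd p + 1 \<and> p \<le> Q \<and>
    \<not> int p dvd int (divisor_sigma l) - int b * int l \<and>
    int p dvd int Q * (int (divisor_sigma l) - int b * int l) + int (divisor_sigma l)"
proof -
  have mn: "m > 0" "n > 0" "divisor_sigma m = divisor_sigma n" "divisor_sigma n = a * m + b * n"
     "largest_prime m \<le> largest_prime n"
    using pair by (auto simp: ordered_pairs_def multiamicable_def)
  have gt1: "k > 1" if "divisor_sigma k = a * m + b * n" "k > 0" for k
  proof (rule ccontr)
    assume "\<not> k > 1"
    then have "k = 1" using that by simp
    then have "a * m + b * n = 1" using that by (simp add: divisor_sigma_def)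
    moreover have "a * m \<ge> 1" "b * n \<ge> 1" using ab mn by (simp_all add: Suc_leI)
    ultimately show False by linarith
  qed
  have m1: "m > 1" "n > 1" using gt1 mn by simp_all
  have Q: "prime Q" using largest_prime(1)[OF m1(2)] by (simp only: n(2))
  have sig: "divisor_sigma n = (Q + 1) * divisor_sigma l"
    unfolding n(1) using n(3) Q
    by (simp add: divisor_sigma_mult_coprime divisor_sigma_prime prime_imp_coprime)
  have "L ^ 3 \<ge> 2 ^ 3" using L by (intro power_mono) auto
  then have L3: "L ^ 3 \<ge> 8" by simp
  have "r dvd divisor_sigma m" using r(3) by (simp add: mn(3) sig)
  moreover have "real r > L ^ 3 / 2" using r L3 by linarith
  ultimately obtain p where p: "prime p" "p dvd m" "r dvd p + 1"
    using typical_prime_dvd_divisor_sigma[OF typic(1) mn(1) r(1)] L by auto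
  have "p \<le> Q" using largest_prime(3)[OF m1(1) p(1,2)] mn(5) unfolding n(2) by (rule order_trans)
  have "r \<le> p + 1" using p by (intro dvd_imp_le) auto
  then have pbig: "real p > L ^ 3 / 2" using r L3 by linarith
  \<comment> \<open>This is \<open>s n - b n = a m\<close>, with \<open>s n = (Q + 1) * s l\<close>.\<close>
  have lin: "int Q * (int (divisor_sigma l) - int b * int l) + int (divisor_sigma l) = int (a * m)"
  proof -
    have "(Q + 1) * divisor_sigma l = a * m + b * (Q * l)" by (simp only: mn(4) sig[symmetric] n(1)[symmetric])
    then have "(int Q + 1) * int (divisor_sigma l) = int (a * m) + int b * (int Q * int l)"
      by (metis of_nat_1 of_nat_add of_nat_mult)
    then show ?thesis by (simp add: algebra_simps)
  qed
  have dv: "int p dvd int Q * (int (divisor_sigma l) - int b * int l) + int (divisor_sigma l)"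
    unfolding lin using p(2) by (simp only: int_dvd_int_iff) simp
  moreover have "\<not> int p dvd int (divisor_sigma l) - int b * int l"
  proof
    assume c: "int p dvd int (divisor_sigma l) - int b * int l"
    then have ps: "int p dvd int (divisor_sigma l)" using dv by (simp add: dvd_add_right_iff)
    then have "int p dvd int b * int l" using c by (simp add: dvd_diff_right_iff)
    then have "p dvd b * l" by (simp flip: of_nat_mult)
    moreover have "\<not> p dvd b"
    proof
      assume "p dvd b"
      then have "real p \<le> real b" using ab by (simp add: dvd_imp_le)
      then show False using pbig L by linarith
    qed
    ultimately have "p dvd l" using p(1) by (simp add: prime_dvd_mult_iff)
    have "p dvd divisor_sigma n" using ps by (simp add: sig)
    then obtain q where q: "prime q" "q dvd n" "p dvd q + 1"
      using typical_prime_dvd_divisor_sigma[OF typic(2) mn(2) p(1)] pbig L by auto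
    have "p \<noteq> q"
    proof
      assume "p = q"
      then have "p dvd 1" using q(3) by (simp only: dvd_add_right_iff dvd_refl)
      then show False using p(1) by simp
    qed
    moreover have "p dvd n" using \<open>p dvd l\<close> by (subst n(1)) simp
    ultimately have "p * q dvd n" using p(1) q(1,2) by (intro divides_mult primes_coprime)
    then show False using typic(2) p(1) q pbig L(1) by (auto simp: typical_def Let_def)
  qed
  ultimately show ?thesis using p \<open>p \<le> Q\<close> by blast
qed

text \<open>Pairs with an atypical member are counted by that member. The other pairs are counted by \<open>n\<close>,
  with \<open>r l\<close> some large prime divisor of \<open>s l\<close> chosen for every \<open>l\<close> that has one.\<close>

lemma card_ordered_pairs_le:
  assumes ab: "a > 0" "b > 0"
    and L: "L = ln (real N)" "L \<ge> 2" "L powr (9/10) - ln L > 0" "exp (L powr (4/5)) \<ge> L / 2"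
      "L ^ 3 \<ge> 2 * real b"
  shows "real (card (ordered_pairs a b N)) \<le> real N * (2 * atypical_bound L + 4 * (1 + L)\<^sup>2 / L ^ 3)"
proof -
  have N: "N > 0" using L by (cases "N = 0") auto
  define X where "X = {n \<in> {1..N}. \<not> typical N n}"
  define G where "G = {(m, n) \<in> ordered_pairs a b N. typical N m \<and> typical N n}"
  define good where "good l r \<longleftrightarrow> prime r \<and> real r > L ^ 3 \<and> r dvd divisor_sigma l" for l r
  define r where "r l = (SOME r. good l r)" for l
  define I where "I = {l \<in> {1..N}. \<exists>r. good l r}"
  define c e where "c l = int (divisor_sigma l) - int b * int l" and "e l = int (divisor_sigma l)" for l
  define T where "T = {n. \<exists>l\<in>I. \<exists>p Q. n = Q * l \<and> n \<le> N \<and> prime p \<and> r l dvd p + 1 \<and> p \<le> Q \<and>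
            \<not> int p dvd c l \<and> int p dvd int Q * c l + e l}"
  have rI: "good l (r l)" if "l \<in> I" for l
    using that unfolding I_def r_def by (auto intro: someI_ex)
  have inj1: "inj_on fst (ordered_pairs a b N)" and inj2: "inj_on snd (ordered_pairs a b N)"
    using ab by (auto simp: inj_on_def ordered_pairs_def multiamicable_def)
  have finO: "finite (ordered_pairs a b N)"
    by (rule finite_subset[of _ "{1..N} \<times> {1..N}"]) (auto simp: ordered_pairs_def)
  have "snd ` G \<subseteq> T"
  proof
    fix n assume "n \<in> snd ` G"
    then obtain m where m: "(m, n) \<in> ordered_pairs a b N" "typical N m" "typical N n"
      by (auto simp: G_def)
    have n: "1 \<le> n" "n \<le> N" using m(1) by (auto simp: ordered_pairs_def)
    have "n \<noteq> 1"
    proof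
      assume "n = 1"
      then have "a * m + b = 1" "m > 0"
        using m(1) by (auto simp: ordered_pairs_def multiamicable_def divisor_sigma_def)
      moreover have "a * m \<ge> 1" using ab \<open>m > 0\<close> by (simp add: Suc_leI)
      ultimately show False using ab by linarith
    qed
    then have n1: "n > 1" using n by simp
    have big: "ln (real N) > 1" "exp (ln (real N) powr (4/5)) \<ge> ln (real N) / 2"
      using L by simp_all
    obtain l r0 where l: "n = largest_prime n * l" "\<not> largest_prime n dvd l"
        and r0: "prime r0" "real r0 > ln (real N) ^ 3" "r0 dvd divisor_sigma l"
      by (rule typical_cofactor[OF m(3) n1 n(2) big])
    then have gl: "good l r0" by (simp add: good_def L(1))
    have "l dvd n" by (subst l(1)) simp
    then have "l \<le> n" "l > 0" using n1 by (auto intro: dvd_imp_le Nat.gr0I)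
    then have lI: "l \<in> I" using n(2) gl by (auto simp: I_def)
    obtain p where "prime p" "r l dvd p + 1" "p \<le> largest_prime n" "\<not> int p dvd c l"
        "int p dvd int (largest_prime n) * c l + e l"
      using typical_pair_congruence[OF ab m l(1) refl l(2), of "r l" L] rI[OF lI] L
      by (auto simp: good_def c_def e_def)
    then show "n \<in> T" unfolding T_def using lI l(1) n(2) by blast
  qed
  moreover have "finite T" by (rule finite_subset[of _ "{..N}"]) (auto simp: T_def)
  ultimately have "card (snd ` G) \<le> card T" by (intro card_mono)
  moreover have "card (snd ` G) = card G"
    by (intro card_image inj_on_subset[OF inj2]) (auto simp: G_def)
  moreover have "real (card T) \<le> real N * (4 * (1 + L)\<^sup>2 / L ^ 3)"
    unfolding T_def L(1)
  proof (rule card_linear_congruence_le)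
    have "2 ^ 3 \<le> L ^ 3" using L(2) by (intro power_mono) auto
    then show "2 \<le> ln (real N) ^ 3" by (simp add: L(1))
    show "ln (real N) ^ 3 \<le> real (r l)" if "l \<in> I" for l
      using rI[OF that] by (simp add: good_def L(1))
  qed (use N in \<open>auto simp: I_def\<close>)
  ultimately have cG: "real (card G) \<le> real N * (4 * (1 + L)\<^sup>2 / L ^ 3)" by simp
  have atyp: "card {z \<in> ordered_pairs a b N. f z \<in> X} \<le> card X" if "inj_on f (ordered_pairs a b N)" for f
    by (rule card_inj_on_le[of f]) (use that in \<open>auto simp: X_def intro: inj_on_subset\<close>)
  have "ordered_pairs a b N \<subseteq>
      {z \<in> ordered_pairs a b N. fst z \<in> X} \<union> ({z \<in> ordered_pairs a b N. snd z \<in> X} \<union> G)"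
    by (auto simp: ordered_pairs_def X_def G_def)
  then have "card (ordered_pairs a b N) \<le>
      card ({z \<in> ordered_pairs a b N. fst z \<in> X} \<union> ({z \<in> ordered_pairs a b N. snd z \<in> X} \<union> G))"
    by (rule card_mono[rotated]) (use finO in \<open>auto simp: G_def case_prod_unfold\<close>)
  also have "\<dots> \<le> card {z \<in> ordered_pairs a b N. fst z \<in> X} + (card {z \<in> ordered_pairs a b N. snd z \<in> X} + card G)"
    by (intro order_trans[OF card_Un_le] add_left_mono) simp
  also have "\<dots> \<le> card X + (card X + card G)"
    by (intro add_mono atyp inj1 inj2 order_refl)
  finally have "real (card (ordered_pairs a b N)) \<le> 2 * real (card X) + real (card G)" by linarith
  moreover have "real (card X) \<le> real N * atypical_bound L"
    unfolding X_def by (rule card_atypical_le[OF L(1-3)])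
  ultimately show ?thesis using cG by (simp add: algebra_simps)
qed

lemma card_ordered_pairs_smallo:
  assumes ab: "a > 0" "b > 0" and "\<epsilon> > 0"
  shows "\<forall>\<^sub>F N in sequentially. real (card (ordered_pairs a b N)) \<le> \<epsilon> * real N"
proof -
  define g where "g L = 2 * atypical_bound L + 4 * (1 + L)\<^sup>2 / L ^ 3" for L
  have "(atypical_bound \<longlongrightarrow> 0 + 0 + 0 + 0 + 0 + 0) at_top"
    unfolding atypical_bound_def by (intro tendsto_add) real_asymp+
  then have "(atypical_bound \<longlongrightarrow> 0) at_top" by simp
  moreover have "((\<lambda>L::real. 4 * (1 + L)\<^sup>2 / L ^ 3) \<longlongrightarrow> 0) at_top" by real_asymp
  ultimately have "(g \<longlongrightarrow> 2 * 0 + 0) at_top" unfolding g_def by (intro tendsto_add tendsto_mult tendsto_const)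
  then have ev1: "\<forall>\<^sub>F L in at_top. g L < \<epsilon>" using assms(3) by (simp add: order_tendsto_iff)
  have ev2: "\<forall>\<^sub>F L::real in at_top. L powr (9/10) - ln L > 0" by real_asymp
  have ev3: "\<forall>\<^sub>F L::real in at_top. exp (L powr (4/5)) \<ge> L / 2" by real_asymp
  have ev4: "\<forall>\<^sub>F L::real in at_top. L ^ 3 \<ge> 2 * real b" by real_asymp
  have lim: "filterlim (\<lambda>N::nat. ln (real N)) at_top sequentially" by real_asymp
  have "\<forall>\<^sub>F L::real in at_top. g L < \<epsilon> \<and> L \<ge> 2 \<and> L powr (9/10) - ln L > 0 \<and>
      exp (L powr (4/5)) \<ge> L / 2 \<and> L ^ 3 \<ge> 2 * real b"
    by (intro eventually_conj ev1 ev2 ev3 ev4 eventually_ge_at_top)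
  from eventually_compose_filterlim[OF this lim] show ?thesis
  proof eventually_elim
    case (elim N)
    then have "real (card (ordered_pairs a b N)) \<le> real N * g (ln (real N))"
      unfolding g_def by (intro card_ordered_pairs_le ab refl) auto
    also have "\<dots> \<le> real N * \<epsilon>" using elim by (intro mult_left_mono) auto
    finally show ?case by (simp add: mult.commute)
  qed
qed

section \<open>Density zero\<close>

text \<open>The integers \<open>m\<close> with \<open>s m \<ge> C m\<close> are bounded in number by Markov's inequality. For the
  others \<open>n \<le> s m < C m\<close>, so both members are at most \<open>C M\<close>, and one of the two orders puts
  the larger of the two largest primes second.\<close>

lemma multiamicable_count_le:
  assumes ab: "\<alpha> > 0" "\<beta> > 0" and "C > 0" and M: "M = nat \<lfloor>x\<rfloor>"
  shows "real (multiamicable_count \<alpha> \<beta> x)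
      \<le> 4 * real M / real C + real (card (ordered_pairs \<alpha> \<beta> (C * M))) + real (card (ordered_pairs \<beta> \<alpha> (C * M)))"
proof -
  define H where "H = {m \<in> {1..M}. real (divisor_sigma m) / real m \<ge> real C}"
  define Z where "Z = {z \<in> multiamicable_pairs \<alpha> \<beta> x. fst z \<in> H}"
  let ?O1 = "ordered_pairs \<alpha> \<beta> (C * M)" and ?O2 = "ordered_pairs \<beta> \<alpha> (C * M)"
  have finO: "finite (ordered_pairs a b N)" for a b N
    by (rule finite_subset[of _ "{1..N} \<times> {1..N}"]) (auto simp: ordered_pairs_def)
  have sub: "multiamicable_pairs \<alpha> \<beta> x \<subseteq> Z \<union> (?O1 \<union> prod.swap ` ?O2)"
  proof
    fix z assume z: "z \<in> multiamicable_pairs \<alpha> \<beta> x"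
    obtain m n where zmn: "z = (m, n)" by (cases z)
    have mn: "m > 0" "n > 0" "divisor_sigma m = divisor_sigma n" "divisor_sigma n = \<alpha> * m + \<beta> * n" "real m \<le> x"
      using z zmn by (auto simp: multiamicable_pairs_def multiamicable_def)
    then have mM: "m \<in> {1..M}" by (auto simp: M le_nat_floor)
    show "z \<in> Z \<union> (?O1 \<union> prod.swap ` ?O2)"
    proof (cases "m \<in> H")
      case False
      then have "real (divisor_sigma m) < real (C * m)" using mM mn by (simp add: H_def field_simps)
      then have "divisor_sigma m < C * m" by (simp only: of_nat_less_iff)
      moreover have "n \<le> divisor_sigma m" using mn ab by (simp add: trans_le_add2)
      ultimately have "n \<le> C * m" by linarith
      also have "\<dots> \<le> C * M" using mM by simp
      finally have "n \<in> {1..C * M}" using mn by simp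
      moreover have "m \<in> {1..C * M}" using mM assms(3) by (auto intro: order_trans[of _ M])
      ultimately have "(m, n) \<in> ?O1 \<or> (n, m) \<in> ?O2"
        using mn by (auto simp: ordered_pairs_def multiamicable_def)
      then show ?thesis unfolding zmn by force
    qed (use z zmn in \<open>simp add: Z_def\<close>)
  qed
  have "card Z \<le> card H"
    by (rule card_inj_on_le[of fst])
       (use ab in \<open>auto simp: inj_on_def Z_def H_def multiamicable_pairs_def multiamicable_def\<close>)
  have finZ: "finite Z" unfolding Z_def using finite_multiamicable_pairs[OF ab(2)] by simp
  have "multiamicable_count \<alpha> \<beta> x \<le> card (Z \<union> (?O1 \<union> prod.swap ` ?O2))"
    unfolding multiamicable_count_def by (intro card_mono sub finite_UnI finZ finO finite_imageI)
  also have "\<dots> \<le> card Z + (card ?O1 + card (prod.swap ` ?O2))"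
    by (intro order_trans[OF card_Un_le] add_left_mono) simp
  also have "\<dots> \<le> card H + (card ?O1 + card ?O2)"
    by (intro add_mono \<open>card Z \<le> card H\<close> card_image_le finO order_refl)
  finally have "real (multiamicable_count \<alpha> \<beta> x) \<le> real (card H) + real (card ?O1) + real (card ?O2)"
    by linarith
  moreover have "real (card H) \<le> 4 * real M / real C"
  proof -
    have "real (card H) \<le> (\<Sum>m\<in>{1..M}. real (divisor_sigma m) / real m) / real C"
      unfolding H_def using assms(3) by (intro card_ge_le_sum_div) auto
    also have "\<dots> \<le> 4 * real M / real C" by (intro divide_right_mono sum_divisor_sigma_div) auto
    finally show ?thesis .
  qed
  ultimately show ?thesis by linarith
qed

theorem theorem2:
  fixes \<alpha> \<beta> :: nat
  assumes "\<alpha> > 0" and "\<beta> > 0"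
  shows "(\<lambda>x::real. real (multiamicable_count \<alpha> \<beta> x)) \<in> o[at_top](\<lambda>x. x)"
proof (rule landau_o.smallI)
  fix \<epsilon> :: real assume eps: "\<epsilon> > 0"
  \<comment> \<open>Half of \<open>\<epsilon>\<close> is spent on the pairs with \<open>s m \<ge> C m\<close>, a quarter on each order.\<close>
  define C where "C = nat \<lceil>8 / \<epsilon>\<rceil>"
  have "real C \<ge> 8 / \<epsilon>" by (simp add: C_def real_nat_ceiling_ge)
  moreover have "8 / \<epsilon> > 0" using eps by simp
  ultimately have C0: "real C > 0" by linarith
  with \<open>real C \<ge> 8 / \<epsilon>\<close> have "4 / real C \<le> \<epsilon> / 2" using eps by (simp add: field_simps)
  note C = C0 this
  define \<delta> where "\<delta> = \<epsilon> / (4 * real C)"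
  have \<delta>: "\<delta> > 0" using eps C by (simp add: \<delta>_def)
  have lim: "filterlim (\<lambda>x::real. C * nat \<lfloor>x\<rfloor>) sequentially at_top"
  proof (rule filterlim_at_top_mono)
    show "filterlim (\<lambda>x::real. nat \<lfloor>x\<rfloor>) sequentially at_top"
      by (intro filterlim_compose[OF filterlim_nat_sequentially filterlim_floor_sequentially])
    show "\<forall>\<^sub>F x::real in at_top. nat \<lfloor>x\<rfloor> \<le> C * nat \<lfloor>x\<rfloor>" using C by simp
  qed
  have "\<forall>\<^sub>F x::real in at_top. real (card (ordered_pairs \<alpha> \<beta> (C * nat \<lfloor>x\<rfloor>))) \<le> \<delta> * real (C * nat \<lfloor>x\<rfloor>)"
       "\<forall>\<^sub>F x::real in at_top. real (card (ordered_pairs \<beta> \<alpha> (C * nat \<lfloor>x\<rfloor>))) \<le> \<delta> * real (C * nat \<lfloor>x\<rfloor>)"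
    by (rule eventually_compose_filterlim[OF card_ordered_pairs_smallo[OF assms \<delta>] lim]
             eventually_compose_filterlim[OF card_ordered_pairs_smallo[OF assms(2,1) \<delta>] lim])+
  with eventually_ge_at_top[of 0]
  show "\<forall>\<^sub>F x in at_top. norm (real (multiamicable_count \<alpha> \<beta> x)) \<le> \<epsilon> * norm x"
  proof eventually_elim
    case (elim x)
    define M where "M = nat \<lfloor>x\<rfloor>"
    have M: "real M \<le> x" using elim by (simp add: M_def)
    have "real (multiamicable_count \<alpha> \<beta> x) \<le> 4 * real M / real C
        + real (card (ordered_pairs \<alpha> \<beta> (C * M))) + real (card (ordered_pairs \<beta> \<alpha> (C * M)))"
      using multiamicable_count_le[OF assms _ M_def, of C] C by simp
    also have "\<dots> \<le> \<epsilon> / 2 * real M + \<delta> * real (C * M) + \<delta> * real (C * M)"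
    proof (intro add_mono)
      have "4 / real C * real M \<le> \<epsilon> / 2 * real M" using C by (intro mult_right_mono) auto
      then show "4 * real M / real C \<le> \<epsilon> / 2 * real M" by simp
    qed (use elim in \<open>auto simp: M_def\<close>)
    also have "\<dots> = \<epsilon> * real M" using C by (simp add: \<delta>_def field_simps)
    also have "\<dots> \<le> \<epsilon> * x" using M eps by (intro mult_left_mono) auto
    finally show ?case using elim by simp
  qed
qed

end
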